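(* Let $s,p\in\mathbb{R}$, $\alpha>1/2$ and $\alpha'\ge0$ satisfy $\min\{\alpha,\alpha'\}+s>0$ and $\min\{\alpha,\alpha'\}+(p-1/2)>0$. Suppose that $l^\dagger=\{l_j^\dagger\}\in\mathcal{H}^s$; that the prior variances satisfy $\sigma_j^2=\Theta(j^{-2p})$ as $j\to\infty$; that the training and test covariances satisfy $\vartheta_j^2=\langle\varphi_j,\Lambda\varphi_j\rangle=\Theta(j^{-2\alpha})$ and $\vartheta_j'^2=\langle\varphi_j,\Lambda'\varphi_j\rangle=\Theta(j^{-2\alpha'})$ as $j\to\infty$; and that the training distribution $\nu$ satisfies the moment assumption (M) in the context. Let $$\rho_N=\begin{cases}N^{-\left(1-\frac{\alpha+1/2-\alpha'}{\alpha+p}\right)},&\alpha'<\alpha+1/2,\\ N^{-1}\log N,&\alpha'=\alpha+1/2,\\ N^{-1},&\alpha'>\alpha+1/2.\end{cases}$$ Then any positive sequence $\{\varepsilon_N\}_{N\in\mathbb{N}}$ such that $\varepsilon_N^2$ is of the order of $O(\rho_N)+o\bigl(N^{-\frac{\alpha'+s}{\alpha+p}}\bigr)$ as $N\to\infty$ is a contraction rate of the posterior $\mu^{D_N}$ with respect to the $L^2_{\nu'}(H;H)$ norm. That is: there is a nonnegative sequence $r_N=o\bigl(N^{-\frac{\alpha'+s}{\alpha+p}}\bigr)$ (depending on $l^\dagger$) such that for every positive sequence $\{\varepsilon_N\}$ with $\varepsilon_N^2=\Theta(\rho_N+r_N)$ and every positive sequence $M_N\to\infty$, $$\mathbb{E}^{D_N}\mu^{D_N}\bigl(\{L:\|L^\dagger-L\|_{L^2_{\nu'}(H;H)}\ge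 M_N\varepsilon_N\}\bigr)\to0\quad\text{as }N\to\infty.$$
   Context: A positive sequence $\varepsilon_N\to0$ is a contraction rate of $\mu^{D_N}$ with respect to the $L^2_{\nu'}(H;H)$ norm if for every positive sequence $M_N\to\infty$, $\mathbb{E}^{D_N}\mu^{D_N}(\{L:\|L^\dagger-L\|_{L^2_{\nu'}(H;H)}\ge M_N\varepsilon_N\})\to0$ as $N\to\infty$. $H$ is a real, separable, infinite-dimensional Hilbert space with inner product $\langle\cdot,\cdot\rangle$ and norm $\|\cdot\|$; $\{\varphi_j\}_{j\in\mathbb{N}}$ is a fixed known orthonormal basis of $H$. For $s\in\mathbb{R}$, $\mathcal{H}^s=\{v:\mathbb{N}\to\mathbb{R}:\|v\|_{\mathcal{H}^s}^2=\sum_jj^{2s}|v_j|^2<\infty\}$. For nonnegative sequences, $a_n=O(b_n)$ means $\limsup a_n/b_n<\infty$, $a_n=\Omega(b_n)$ means $b_n=O(a_n)$, $a_n=\Theta(b_n)$ means both, $a_n=o(b_n)$ means $a_n/b_n\to0$. Truth: $L^\dagger=\sum_jl_j^\dagger\varphi_j\otimes\varphi_j$ is a fixed, possibly unbounded, self-adjoint operator on $H$ with real eigenvalues $l_j^\dagger$ and domain $\{h\in H:\sum_j|l_j^\dagger|^2\langle\varphi_j,h\rangle^2<\infty\}$. Data: $\gamma>0$ is fixed; $\nu$ is a centered Borel probability measure on $H$ with finite second moment and strictly positive-definite trace-class covariance operator $\Lambda$; $x_1,\dots,x_N$ are i.i.d. from $\nu$; $g_{jn}=\langle\varphi_j,x_n\rangle$;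 $y_{jn}=g_{jn}l_j^\dagger+\gamma\xi_{jn}$ for $j\in\mathbb{N}$, $1\le n\le N$, with $\xi_{jn}$ i.i.d. $\mathcal{N}(0,1)$ independent of $X=(x_1,\dots,x_N)$. $Y=\{y_{jn}\}$, $D_N=(X,Y)$, and $\mathbb{E}^{D_N}$ is expectation over the joint law of $D_N$. Prior and posterior: the prior on the eigenvalues is $\bigotimes_j\mathcal{N}(0,\sigma_j^2)$ with $\sigma_j^2>0$ for all $j$. The posterior on the eigenvalues is $\bigotimes_j\mathcal{N}(\bar l_j^{(N)},(\sigma_j^{(N)})^2)$ with $$\bar l_j^{(N)}=\frac{N\gamma^{-2}\sigma_j^2\,\frac1N\sum_{n}y_{jn}g_{jn}}{1+N\gamma^{-2}\sigma_j^2\,\frac1N\sum_ng_{jn}^2},\qquad(\sigma_j^{(N)})^2=\frac{\sigma_j^2}{1+N\gamma^{-2}\sigma_j^2\,\frac1N\sum_ng_{jn}^2}.$$ $\mu^{D_N}$ is the law of $L^{(N)}=\sum_jl_j^{(N)}\varphi_j\otimes\varphi_j$ with $\{l_j^{(N)}\}$ drawn from this posterior. Test distribution: $\nu'$ is a centered Borel probability measure with bounded covariance operator $\Lambda'\in\mathcal{L}(H)$ (possibly not trace-class). For $T=\sum_jt_j\varphi_j\otimes\varphi_j$, $\|T\|^2_{L^2_{\nu'}(H;H)}=\mathbb{E}^{x\sim\nu'}\|Tx\|^2=\sum_j\vartheta_j'^2t_j^2$, where $\vartheta_j'^2=\langle\varphi_j,\Lambda'\varphi_j\rangle$. Assumption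 (M): $x\sim\nu$ has Karhunen–Loève expansion $x=\sum_k\lambda_k\zeta_k\phi_k$, where $\{\phi_k\}$ is an orthonormal eigenbasis of $\Lambda$ with nonincreasing eigenvalues $\lambda_k^2$, and the zero mean, unit variance random variables $\{\zeta_k\}$ are independent, have finite fourth moments, and satisfy $\mathbb{E}[\zeta_k^4]=O(1)$ as $k\to\infty$. Moreover, there is a constant $C$ such that $\limsup_{N\to\infty}\mathbb{E}\bigl[(\frac1N\sum_{n=1}^Ng_{jn}^2)^{-4}\bigr]\le C\langle\varphi_j,\Lambda\varphi_j\rangle^{-4}$ for all $j\in\mathbb{N}$. *)

theory Defs
  imports "HOL-Probability.Probability" "HOL-Library.Landau_Symbols"
begin

text \<open>
  Sequences indexed by the positive integers are functions on \<open>nat\<close> whose value at \<open>j\<close>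
  is the entry with index \<open>j + 1\<close>; every weight is therefore a power of \<open>Suc j\<close>.
\<close>

definition orthonormal_basis :: "(nat \<Rightarrow> 'h::real_inner) \<Rightarrow> bool" where
  "orthonormal_basis \<phi> \<longleftrightarrow>
     (\<forall>i j. \<phi> i \<bullet> \<phi> j = (if i = j then 1 else 0)) \<and> closure (span (range \<phi>)) = UNIV"

definition sobolev_seq :: "real \<Rightarrow> (nat \<Rightarrow> real) set" where
  "sobolev_seq s = {v. summable (\<lambda>j. real (Suc j) powr (2 * s) * \<bar>v j\<bar>\<^sup>2)}"


section \<open>Training distribution\<close>

text \<open>
  For a positive operator, being trace-class means that the diagonal entries in some
  (equivalently, every) orthonormal basis are summable.
\<close>

definition training_distribution ::
  "(nat \<Rightarrow> 'h::{real_inner,banach,second_countable_topology}) \<Rightarrow> 'h measure \<Rightarrow> ('h \<Rightarrow> 'h) \<Rightarrow> bool"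
  where
  "training_distribution \<phi> \<nu> \<Lambda> \<longleftrightarrow>
     prob_space \<nu> \<and> sets \<nu> = sets borel \<and>
     integrable \<nu> (\<lambda>x. (norm x)\<^sup>2) \<and> (\<integral>x. x \<partial>\<nu>) = 0 \<and>
     bounded_linear \<Lambda> \<and> (\<forall>h k. (\<integral>x. (h \<bullet> x) * (k \<bullet> x) \<partial>\<nu>) = h \<bullet> \<Lambda> k) \<and>
     (\<forall>h. h \<noteq> 0 \<longrightarrow> 0 < h \<bullet> \<Lambda> h) \<and> summable (\<lambda>j. \<phi> j \<bullet> \<Lambda> (\<phi> j))"

text \<open>
  Assumption (M).  Since all eigenvalues are positive, the variables \<open>\<zeta> k\<close> of the
  Karhunen-Loeve expansion are functions of \<open>x\<close>, so they live on the space of \<open>\<nu>\<close> itself.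
  The negative moment is taken in the extended nonnegative reals, where the inverse
  of \<open>0\<close> is infinite.
\<close>

definition assumption_M ::
  "(nat \<Rightarrow> 'h::{real_inner,banach,second_countable_topology}) \<Rightarrow> 'h measure \<Rightarrow> ('h \<Rightarrow> 'h) \<Rightarrow> bool"
  where
  "assumption_M \<phi> \<nu> \<Lambda> \<longleftrightarrow>
     (\<exists>e lam (\<zeta> :: nat \<Rightarrow> 'h \<Rightarrow> real).
        orthonormal_basis e \<and> (\<forall>k. 0 < lam k) \<and>
        (\<forall>k. \<Lambda> (e k) = (lam k)\<^sup>2 *\<^sub>R e k) \<and> decseq (\<lambda>k. (lam k)\<^sup>2) \<and>
        (AE x in \<nu>. (\<lambda>k. (lam k * \<zeta> k x) *\<^sub>R e k) sums x) \<and>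
        prob_space.indep_vars \<nu> (\<lambda>_. borel) \<zeta> UNIV \<and>
        (\<forall>k. integrable \<nu> (\<lambda>x. (\<zeta> k x) ^ 4) \<and>
             (\<integral>x. \<zeta> k x \<partial>\<nu>) = 0 \<and> (\<integral>x. (\<zeta> k x)\<^sup>2 \<partial>\<nu>) = 1) \<and>
        (\<lambda>k. \<integral>x. (\<zeta> k x) ^ 4 \<partial>\<nu>) \<in> O(\<lambda>_. 1)) \<and>
     (\<exists>C::real. \<forall>j.
        limsup (\<lambda>N. \<integral>\<^sup>+X. inverse (ennreal ((1 / real N) * (\<Sum>n<N. (\<phi> j \<bullet> X n)\<^sup>2))) ^ 4
                       \<partial>(\<Pi>\<^sub>M n\<in>{..<N}. \<nu>))
        \<le> ennreal (C / (\<phi> j \<bullet> \<Lambda> (\<phi> j)) ^ 4))"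


section \<open>Data and posterior\<close>

definition gaussian :: "real \<Rightarrow> real \<Rightarrow> real measure" where
  "gaussian m sd = density lborel (\<lambda>x. ennreal (normal_density m sd x))"

text \<open>
  The joint law of \<open>D = (X, Y)\<close> is the image of the product law of \<open>(X, \<xi>)\<close>.
\<close>

definition data_law ::
  "(nat \<Rightarrow> 'h::{real_inner,banach,second_countable_topology}) \<Rightarrow> 'h measure \<Rightarrow> real \<Rightarrow> (nat \<Rightarrow> real)
     \<Rightarrow> nat \<Rightarrow> ((nat \<Rightarrow> 'h) \<times> (nat \<times> nat \<Rightarrow> real)) measure"
  where
  "data_law \<phi> \<nu> \<gamma> l N =
     distr ((\<Pi>\<^sub>M n\<in>{..<N}. \<nu>) \<Otimes>\<^sub>M (\<Pi>\<^sub>M jn\<in>UNIV \<times> {..<N}. gaussian 0 1))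
           ((\<Pi>\<^sub>M n\<in>{..<N}. borel) \<Otimes>\<^sub>M (\<Pi>\<^sub>M jn\<in>UNIV \<times> {..<N}. borel))
           (\<lambda>(X, \<xi>). (X, \<lambda>(j, n)\<in>UNIV \<times> {..<N}. (\<phi> j \<bullet> X n) * l j + \<gamma> * \<xi> (j, n)))"

fun posterior_mean ::
  "(nat \<Rightarrow> 'h::real_inner) \<Rightarrow> real \<Rightarrow> (nat \<Rightarrow> real) \<Rightarrow> nat
     \<Rightarrow> (nat \<Rightarrow> 'h) \<times> (nat \<times> nat \<Rightarrow> real) \<Rightarrow> nat \<Rightarrow> real"
  where
  "posterior_mean \<phi> \<gamma> \<sigma> N (X, Y) j =
     (real N / \<gamma>\<^sup>2 * (\<sigma> j)\<^sup>2 * ((1 / real N) * (\<Sum>n<N. Y (j, n) * (\<phi> j \<bullet> X n)))) /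
     (1 + real N / \<gamma>\<^sup>2 * (\<sigma> j)\<^sup>2 * ((1 / real N) * (\<Sum>n<N. (\<phi> j \<bullet> X n)\<^sup>2)))"

fun posterior_var ::
  "(nat \<Rightarrow> 'h::real_inner) \<Rightarrow> real \<Rightarrow> (nat \<Rightarrow> real) \<Rightarrow> nat
     \<Rightarrow> (nat \<Rightarrow> 'h) \<times> (nat \<times> nat \<Rightarrow> real) \<Rightarrow> nat \<Rightarrow> real"
  where
  "posterior_var \<phi> \<gamma> \<sigma> N (X, Y) j =
     (\<sigma> j)\<^sup>2 / (1 + real N / \<gamma>\<^sup>2 * (\<sigma> j)\<^sup>2 * ((1 / real N) * (\<Sum>n<N. (\<phi> j \<bullet> X n)\<^sup>2)))"

text \<open>
  An operator \<open>\<Sum>j. t j (\<phi> j \<otimes> \<phi> j)\<close> is represented by its sequence \<open>t\<close> of eigenvalues,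
  so the posterior is a measure on sequences.
\<close>

definition posterior ::
  "(nat \<Rightarrow> 'h::real_inner) \<Rightarrow> real \<Rightarrow> (nat \<Rightarrow> real) \<Rightarrow> nat
     \<Rightarrow> (nat \<Rightarrow> 'h) \<times> (nat \<times> nat \<Rightarrow> real) \<Rightarrow> (nat \<Rightarrow> real) measure"
  where
  "posterior \<phi> \<gamma> \<sigma> N D =
     (\<Pi>\<^sub>M j\<in>UNIV. gaussian (posterior_mean \<phi> \<gamma> \<sigma> N D j) (sqrt (posterior_var \<phi> \<gamma> \<sigma> N D j)))"


section \<open>Test distribution and test norm\<close>

text \<open>
  If the covariance operator of the test distribution is not trace-class, the distribution
  is not carried by \<open>H\<close> but by a larger space of formal series \<open>\<Sum>j. x j *\<^sub>R \<phi> j\<close>.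
  It is therefore a Borel measure on the sequences \<open>x\<close> of coefficients.  A Borel measure
  on \<open>H\<close> enters through \<open>coordinate_law\<close>; see the two lemmas at the end.
\<close>

definition test_distribution ::
  "(nat \<Rightarrow> 'h::real_inner) \<Rightarrow> (nat \<Rightarrow> real) measure \<Rightarrow> ('h \<Rightarrow> 'h) \<Rightarrow> bool"
  where
  "test_distribution \<phi> \<nu>' \<Lambda>' \<longleftrightarrow>
     prob_space \<nu>' \<and> sets \<nu>' = sets borel \<and>
     (\<forall>j. integrable \<nu>' (\<lambda>x. (x j)\<^sup>2) \<and> (\<integral>x. x j \<partial>\<nu>') = 0) \<and>
     bounded_linear \<Lambda>' \<and> (\<forall>i j. (\<integral>x. x i * x j \<partial>\<nu>') = \<phi> i \<bullet> \<Lambda>' (\<phi> j))"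

text \<open>
  The action of \<open>\<Sum>j. t j (\<phi> j \<otimes> \<phi> j)\<close> on \<open>\<Sum>j. x j *\<^sub>R \<phi> j\<close>, with values in \<open>H\<close>, and its domain.
\<close>

definition diag_dom :: "(nat \<Rightarrow> real) \<Rightarrow> (nat \<Rightarrow> real) set" where
  "diag_dom t = {x. summable (\<lambda>j. (t j * x j)\<^sup>2)}"

definition diag_op :: "(nat \<Rightarrow> 'h::real_inner) \<Rightarrow> (nat \<Rightarrow> real) \<Rightarrow> (nat \<Rightarrow> real) \<Rightarrow> 'h" where
  "diag_op \<phi> t x = (\<Sum>j. (t j * x j) *\<^sub>R \<phi> j)"

definition test_norm_sq ::
  "(nat \<Rightarrow> 'h::real_inner) \<Rightarrow> (nat \<Rightarrow> real) measure \<Rightarrow> (nat \<Rightarrow> real) \<Rightarrow> ennreal"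
  where
  "test_norm_sq \<phi> \<nu>' t =
     (\<integral>\<^sup>+x. (if x \<in> diag_dom t then ennreal ((norm (diag_op \<phi> t x))\<^sup>2) else \<infinity>) \<partial>\<nu>')"

definition test_norm ::
  "(nat \<Rightarrow> 'h::real_inner) \<Rightarrow> (nat \<Rightarrow> real) measure \<Rightarrow> (nat \<Rightarrow> real) \<Rightarrow> ennreal"
  where
  "test_norm \<phi> \<nu>' t =
     (if test_norm_sq \<phi> \<nu>' t = \<infinity> then \<infinity> else ennreal (sqrt (enn2real (test_norm_sq \<phi> \<nu>' t))))"


section \<open>Contraction rates\<close>

definition contraction_rate ::
  "(nat \<Rightarrow> 'h::{real_inner,banach,second_countable_topology}) \<Rightarrow> 'h measure \<Rightarrow> (nat \<Rightarrow> real) measure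
     \<Rightarrow> real \<Rightarrow> (nat \<Rightarrow> real) \<Rightarrow> (nat \<Rightarrow> real) \<Rightarrow> (nat \<Rightarrow> real) \<Rightarrow> bool"
  where
  "contraction_rate \<phi> \<nu> \<nu>' \<gamma> \<sigma> l \<epsilon> \<longleftrightarrow>
     (\<forall>N. 0 < \<epsilon> N) \<and> \<epsilon> \<longlonglongrightarrow> 0 \<and>
     (\<forall>M :: nat \<Rightarrow> real. (\<forall>N. 0 < M N) \<and> filterlim M at_top sequentially \<longrightarrow>
        (\<lambda>N. \<integral>\<^sup>+D. emeasure (posterior \<phi> \<gamma> \<sigma> N D)
                      {l'. test_norm \<phi> \<nu>' (\<lambda>j. l j - l' j) \<ge> ennreal (M N * \<epsilon> N)}
                   \<partial>(data_law \<phi> \<nu> \<gamma> l N)) \<longlonglongrightarrow> 0)"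

definition rate_rho :: "real \<Rightarrow> real \<Rightarrow> real \<Rightarrow> nat \<Rightarrow> real" where
  "rate_rho \<alpha> \<alpha>' p N =
     (if \<alpha>' < \<alpha> + 1/2 then real N powr (- (1 - (\<alpha> + 1/2 - \<alpha>') / (\<alpha> + p)))
      else if \<alpha>' = \<alpha> + 1/2 then real N powr (-1) * ln (real N)
      else real N powr (-1))"


section \<open>Test distributions on the Hilbert space\<close>

definition coordinate_law ::
  "(nat \<Rightarrow> 'h::{real_inner,second_countable_topology}) \<Rightarrow> 'h measure \<Rightarrow> (nat \<Rightarrow> real) measure" where
  "coordinate_law \<phi> \<mu> = distr \<mu> borel (\<lambda>h j. \<phi> j \<bullet> h)"

lemma measurable_coordinates:
  fixes \<phi> :: "nat \<Rightarrow> 'h::{real_inner,second_countable_topology}"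
  assumes "sets \<mu> = sets borel"
  shows "(\<lambda>h j. \<phi> j \<bullet> h) \<in> \<mu> \<rightarrow>\<^sub>M borel"
proof -
  have "continuous_on UNIV (\<lambda>h j. \<phi> j \<bullet> h)"
    by (intro continuous_on_coordinatewise_then_product continuous_intros)
  then have "(\<lambda>h j. \<phi> j \<bullet> h) \<in> borel \<rightarrow>\<^sub>M borel"
    by (rule borel_measurable_continuous_onI)
  then show ?thesis
    using assms by (simp cong: measurable_cong_sets)
qed

lemma test_distribution_coordinate_law:
  fixes \<phi> :: "nat \<Rightarrow> 'h::{real_inner,banach,second_countable_topology}"
  assumes "prob_space \<mu>" and S: "sets \<mu> = sets borel"
    and "integrable \<mu> (\<lambda>h. (norm h)\<^sup>2)" and "(\<integral>h. h \<partial>\<mu>) = 0"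
    and "bounded_linear \<Lambda>'" and "\<And>h k. (\<integral>x. (h \<bullet> x) * (k \<bullet> x) \<partial>\<mu>) = h \<bullet> \<Lambda>' k"
  shows "test_distribution \<phi> (coordinate_law \<phi> \<mu>) \<Lambda>'"
proof -
  interpret prob_space \<mu> by fact
  note m [measurable] = measurable_coordinates [OF S, of \<phi>]
  have [measurable]: "(\<lambda>h. h) \<in> borel_measurable \<mu>"
    using S by (simp add: measurable_ident_sets)
  have ev [measurable]: "(\<lambda>x. x j) \<in> borel_measurable borel" for j :: nat
    by (rule borel_measurable_continuous_onI) (rule continuous_on_product_coordinates)
  have int2: "integrable \<mu> (\<lambda>h. (\<phi> j \<bullet> h)\<^sup>2)" for j
  proof (rule Bochner_Integration.integrable_bound)
    show "integrable \<mu> (\<lambda>h. (norm (\<phi> j))\<^sup>2 * (norm h)\<^sup>2)"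
      using assms(3) by simp
    have "(\<phi> j \<bullet> h)\<^sup>2 \<le> (norm (\<phi> j))\<^sup>2 * (norm h)\<^sup>2" for h
      using Cauchy_Schwarz_ineq [of "\<phi> j" h] by (simp add: power2_norm_eq_inner)
    then show "AE h in \<mu>. norm ((\<phi> j \<bullet> h)\<^sup>2) \<le> norm ((norm (\<phi> j))\<^sup>2 * (norm h)\<^sup>2)"
      by simp
  qed measurable
  have "integrable \<mu> (\<lambda>h. norm h)"
    by (rule square_integrable_imp_integrable) (use assms(3) in auto)
  then have "integrable \<mu> (\<lambda>h. h)"
    by (simp add: integrable_norm_iff)
  then have "(\<integral>h. \<phi> j \<bullet> h \<partial>\<mu>) = 0" for j
    using assms(4) by simp
  then show ?thesis
    unfolding test_distribution_def coordinate_law_def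
    using assms(5,6) int2 m ev
    by (auto simp: integrable_distr_eq integral_distr intro: prob_space_distr)
qed

lemma test_norm_sq_coordinate_law:
  fixes \<phi> :: "nat \<Rightarrow> 'h::{real_inner,banach,second_countable_topology}"
  assumes "sets \<mu> = sets borel"
  shows "test_norm_sq \<phi> (coordinate_law \<phi> \<mu>) t =
    (\<integral>\<^sup>+h. (if summable (\<lambda>j. (t j)\<^sup>2 * (\<phi> j \<bullet> h)\<^sup>2)
           then ennreal ((norm (\<Sum>j. (t j * (\<phi> j \<bullet> h)) *\<^sub>R \<phi> j))\<^sup>2) else \<infinity>) \<partial>\<mu>)"
proof -
  have ev [measurable]: "(\<lambda>x. x j) \<in> borel_measurable borel" for j :: nat
    by (rule borel_measurable_continuous_onI) (rule continuous_on_product_coordinates)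
  have meas: "(\<lambda>x::nat \<Rightarrow> real. \<Sum>i<n. (t i * x i)\<^sup>2) \<in> borel_measurable borel" for n
    using ev by (intro borel_measurable_sum borel_measurable_power borel_measurable_times) auto
  have "{x \<in> space borel. Cauchy (\<lambda>n. \<Sum>i<n. (t i * x i)\<^sup>2)} \<in> sets borel"
    by (rule sets_Collect_Cauchy) (rule meas)
  then have dom: "{x \<in> space borel. summable (\<lambda>j. (t j * x j)\<^sup>2)} \<in> sets borel"
    by (simp add: summable_iff_convergent Cauchy_convergent_iff)
  have op: "(\<lambda>x. \<Sum>j. (t j * x j) *\<^sub>R \<phi> j) \<in> borel_measurable borel"
    using ev by (intro borel_measurable_suminf borel_measurable_scaleR borel_measurable_times) auto
  have "(\<lambda>x. ennreal ((norm (\<Sum>j. (t j * x j) *\<^sub>R \<phi> j))\<^sup>2)) \<in> borel_measurable borel"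
    by (intro measurable_compose [OF _ measurable_ennreal] borel_measurable_power
        measurable_compose [OF op]) simp
  then have "(\<lambda>x::nat \<Rightarrow> real. if summable (\<lambda>j. (t j * x j)\<^sup>2)
          then ennreal ((norm (\<Sum>j. (t j * x j) *\<^sub>R \<phi> j))\<^sup>2) else \<infinity>) \<in> borel_measurable borel"
    using dom by (intro measurable_If) auto
  then show ?thesis
    unfolding test_norm_sq_def coordinate_law_def diag_dom_def diag_op_def mem_Collect_eq
    by (subst nn_integral_distr [OF measurable_coordinates [OF assms]])
       (simp_all only: power_mult_distrib measurable_distr_eq1)
qed

end

theory Submission
  imports Defs "HOL-Real_Asymp.Real_Asymp"
begin

text \<open>
  By Markov's inequality, the posterior probability of an error larger than \<open>M N * \<epsilon> N\<close> has expectation at most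
  the expected posterior mean square error divided by \<open>(M N * \<epsilon> N)\<^sup>2\<close>. The test norm is a weighted
  \<open>\<ell>\<^sup>2\<close> norm of the eigenvalues, so the mean square error is a weighted sum over the
  coordinates, and it suffices to bound it by a multiple of \<open>rate_rho \<alpha> \<alpha>' p N + r N\<close> (lemma
  \<open>expected_risk_rate\<close>).

  Write \<open>G j\<close> for the empirical variance of the coordinate \<open>j\<close> of the inputs. Conditionally on the inputs the model
  is Gaussian and conjugate, and the risk in coordinate \<open>j\<close> is at most
  \<open>((l j)\<^sup>2 + 2 * (\<sigma> j)\<^sup>2) / (1 + N / \<gamma>\<^sup>2 * (\<sigma> j)\<^sup>2 * G j)\<close> (lemma \<open>conditional_risk_le\<close>). The
  probabilistic core is to replace \<open>G j\<close> by its mean \<open>\<phi> j \<bullet> \<Lambda> (\<phi> j)\<close>, with constants that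
  do not depend on \<open>j\<close>. A nonnegative variable whose second moment is comparable to the square of
  its mean has an exponentially light lower tail for its empirical averages. The squares
  \<open>(\<phi> j \<bullet> x)\<^sup>2\<close> are such variables, uniformly in \<open>j\<close>, because the Karhunen-Loeve expansion
  bounds the kurtosis of all marginals by one constant (lemma \<open>fourth_moment_marginal\<close>). Therefore the expected
  shrinkage factor is at most twice its deterministic counterpart plus an exponentially small
  number (lemma \<open>expected_shrinkage_le\<close>).

  What remains is to estimate two deterministic series. With \<open>q = \<alpha> + p\<close>, both are damped by the factor
  \<open>1 / (1 + N * Suc j powr (- 2 * q))\<close>. The prior variances give a power series, which a cut at
  \<open>N powr (1 / (2 * q))\<close> shows to be at most of order \<open>rate_rho \<alpha> \<alpha>' p N\<close> (lemma \<open>powr_damped_series_le_rate\<close>). The truth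
  gives a series with Sobolev weights, which is \<open>o(N powr (- (\<alpha>' + s) / q))\<close> by dominated convergence when
  \<open>\<alpha>' + s < q\<close> and \<open>O(1 / N)\<close> otherwise (lemma \<open>sobolev_damped_series_le\<close>). In the first case
  this series is the sequence \<open>r\<close>, which therefore depends on \<open>l\<close>.
\<close>

section \<open>Power sums and damped series\<close>

text \<open>
  The weights are positive everywhere, so an eventual bound extends to every index after enlarging
  the constant by finitely many ratios. This turns the asymptotic hypotheses on the variances into
  inequalities that can be summed over all coordinates.
\<close>
lemma bigo_pointwise_bound:
  fixes f :: "nat \<Rightarrow> real"
  assumes "f \<in> O(g)" and g: "\<And>j. g j > 0"
  obtains C where "C > 0" "\<And>j. \<bar>f j\<bar> \<le> C * g j"
proof -
  obtain c where c: "c > 0" "\<forall>\<^sub>F j in sequentially. norm (f j) \<le> c * norm (g j)"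
    using assms(1) by (auto elim: landau_o.bigE)
  then obtain n where n: "\<And>j. j \<ge> n \<Longrightarrow> norm (f j) \<le> c * norm (g j)"
    by (auto simp: eventually_sequentially)
  define C where "C = c + (\<Sum>j<n. \<bar>f j\<bar> / g j)"
  have s: "(\<Sum>j<n. \<bar>f j\<bar> / g j) \<ge> 0" using g by (intro sum_nonneg) (simp add: less_imp_le)
  have "\<bar>f j\<bar> \<le> C * g j" for j
  proof (cases "j < n")
    case True
    have "\<bar>f j\<bar> / g j \<le> (\<Sum>j<n. \<bar>f j\<bar> / g j)"
      using True g by (intro member_le_sum) (auto simp: less_imp_le)
    then have "\<bar>f j\<bar> / g j \<le> C" using c by (simp add: C_def)
    then show ?thesis using g [of j] by (simp add: divide_le_eq)
  next
    case False
    then have "\<bar>f j\<bar> \<le> c * g j" using n [of j] g [of j] by simp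
    also have "\<dots> \<le> C * g j" using s g [of j] by (intro mult_right_mono) (auto simp: C_def)
    finally show ?thesis .
  qed
  moreover have "C > 0" using c s by (simp add: C_def)
  ultimately show ?thesis using that by blast
qed

lemma bigo_tendsto_zero:
  fixes f g :: "'a \<Rightarrow> real"
  assumes "f \<in> O[F](g)" "(g \<longlongrightarrow> 0) F"
  shows "(f \<longlongrightarrow> 0) F"
proof -
  obtain c where c: "\<forall>\<^sub>F x in F. norm (f x) \<le> c * norm (g x)"
    using assms(1) by (elim landau_o.bigE)
  have "((\<lambda>x. c * norm (g x)) \<longlongrightarrow> 0) F"
    by (intro tendsto_mult_right_zero tendsto_norm_zero assms(2))
  then show ?thesis by (rule Lim_null_comparison [OF c])
qed

text \<open>
  For a nonnegative exponent every term is at most the last one; for a negative one, the mean value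
  theorem compares the summand with an increment of the primitive \<open>x powr (b + 1) / (b + 1)\<close>.
\<close>
lemma sum_powr_le_powr:
  fixes b :: real
  assumes "b > -1"
  obtains C where "C \<ge> 0" "\<And>n. (\<Sum>j<n. real (Suc j) powr b) \<le> C * real n powr (b + 1)"
proof (cases "b \<ge> 0")
  case True
  have "(\<Sum>j<n. real (Suc j) powr b) \<le> 1 * real n powr (b + 1)" for n
  proof (cases "n = 0")
    case False
    have "(\<Sum>j<n. real (Suc j) powr b) \<le> (\<Sum>j<n. real n powr b)"
      using True by (intro sum_mono powr_mono2) auto
    also have "\<dots> = real n powr (b + 1)"
      using False by (simp add: powr_add)
    finally show ?thesis by simp
  qed simp
  then show ?thesis by (rule that [of 1, rotated]) simp
next
  case False
  have step: "real (Suc n) powr b \<le> (real (Suc n) powr (b + 1) - real n powr (b + 1)) / (b + 1)" for n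
  proof (cases "n = 0")
    case True
    then show ?thesis using assms False by (simp add: field_simps)
  next
    case n: False
    have "\<exists>z. real n < z \<and> z < real (Suc n) \<and>
        real (Suc n) powr (b + 1) - real n powr (b + 1) = (real (Suc n) - real n) * ((b + 1) * z powr b)"
      using n by (intro MVT2) (auto intro!: derivative_eq_intros simp: powr_diff field_simps)
    then obtain z where z: "real n < z" "z < real (Suc n)"
      and eq: "real (Suc n) powr (b + 1) - real n powr (b + 1) = (b + 1) * z powr b" by auto
    have "real (Suc n) powr b \<le> z powr b"
      using z n False by (intro powr_mono2') auto
    then show ?thesis using assms unfolding eq by simp
  qed
  have "(\<Sum>j<n. real (Suc j) powr b) \<le> 1 / (b + 1) * real n powr (b + 1)" for n
  proof (induction n)
    case (Suc n)
    show ?case using Suc step [of n] by (simp add: diff_divide_distrib)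
  qed simp
  then show ?thesis using assms by (intro that [of "1 / (b + 1)"]) auto
qed

text \<open>
  Telescoping against the primitive \<open>- x powr (1 - c) / (c - 1)\<close>.
\<close>
lemma suminf_powr_tail_le:
  fixes c :: real
  assumes "c > 1" "n \<ge> 1"
  shows "summable (\<lambda>j. real (Suc (j + n)) powr (- c))"
    and "(\<Sum>j. real (Suc (j + n)) powr (- c)) \<le> real n powr (1 - c) / (c - 1)"
proof -
  show *: "summable (\<lambda>j. real (Suc (j + n)) powr (- c))"
    using assms summable_real_powr_iff [of "- c"] summable_iff_shift [of "\<lambda>j. real j powr (- c)" "Suc n"]
    by simp
  have step: "real (Suc m) powr (- c) \<le> (real m powr (1 - c) - real (Suc m) powr (1 - c)) / (c - 1)"
    if "m \<ge> 1" for m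
  proof -
    have "\<exists>z. real m < z \<and> z < real (Suc m) \<and>
        real (Suc m) powr (1 - c) - real m powr (1 - c) = (real (Suc m) - real m) * ((1 - c) * z powr (- c))"
      using that has_real_derivative_powr [of _ "1 - c"] by (intro MVT2) auto
    then obtain z where z: "real m < z" "z < real (Suc m)"
      and eq: "real m powr (1 - c) - real (Suc m) powr (1 - c) = (c - 1) * z powr (- c)"
      by (auto simp: algebra_simps)
    have "real (Suc m) powr (- c) \<le> z powr (- c)"
      using z that assms by (intro powr_mono2') auto
    then show ?thesis using assms unfolding eq by simp
  qed
  have part: "(\<Sum>j<k. real (Suc (j + n)) powr (- c)) \<le>
      (real n powr (1 - c) - real (n + k) powr (1 - c)) / (c - 1)" for k
  proof (induction k)
    case (Suc k)
    show ?case using Suc step [of "k + n"] assms by (simp add: diff_divide_distrib algebra_simps)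
  qed simp
  show "(\<Sum>j. real (Suc (j + n)) powr (- c)) \<le> real n powr (1 - c) / (c - 1)"
  proof (rule suminf_le_const [OF *])
    fix k
    have "(real n powr (1 - c) - real (n + k) powr (1 - c)) / (c - 1) \<le> real n powr (1 - c) / (c - 1)"
      using assms by (intro divide_right_mono) auto
    then show "(\<Sum>j<k. real (Suc (j + n)) powr (- c)) \<le> real n powr (1 - c) / (c - 1)"
      using part [of k] by linarith
  qed
qed

lemma harmonic_sum_le:
  assumes "n \<ge> 1"
  shows "(\<Sum>j<n. 1 / real (Suc j)) \<le> 1 + ln (real n)"
  using assms
proof (induction n rule: nat_induct_at_least)
  case (Suc n)
  have "ln (real n / real (Suc n)) \<le> real n / real (Suc n) - 1"
    using Suc by (intro ln_le_minus_one) auto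
  also have "\<dots> = - (1 / real (Suc n))" by (simp add: field_simps)
  finally have "1 / real (Suc n) \<le> ln (real (Suc n)) - ln (real n)"
    using Suc by (subst (asm) ln_div) auto
  then show ?case using Suc by simp
qed simp

text \<open>
  The factor by which \<open>N\<close> observations reduce the prior uncertainty of coordinate \<open>j\<close>, when prior
  variance times covariate variance is exactly \<open>Suc j powr (- 2 * q)\<close> and the noise has variance \<open>1\<close>.
\<close>
definition damped :: "real \<Rightarrow> nat \<Rightarrow> nat \<Rightarrow> real" where
  "damped q N j = 1 / (1 + real N * real (Suc j) powr (- 2 * q))"

lemma damped_pos: "damped q N j > 0"
  and damped_le_1: "damped q N j \<le> 1"
  unfolding damped_def by (auto simp: add_pos_nonneg field_simps)

lemma damped_le_inverse:
  assumes "N \<ge> 1"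
  shows "damped q N j \<le> real (Suc j) powr (2 * q) / real N"
proof -
  have "damped q N j \<le> 1 / (real N * real (Suc j) powr (- 2 * q))"
    unfolding damped_def using assms by (intro divide_left_mono) (auto simp: add_pos_nonneg)
  also have "\<dots> = real (Suc j) powr (2 * q) / real N"
    by (simp add: powr_minus field_simps)
  finally show ?thesis .
qed

text \<open>
  Below the cut \<open>n\<close> the data dominate and the damping is used as \<open>damped q N j \<le> Suc j powr (2 * q) / N\<close>;
  above it the prior dominates and the damping is bounded by \<open>1\<close>.
\<close>
lemma powr_damped_series_le_split:
  fixes c q :: real
  assumes c: "c > 1" and N: "N \<ge> 1" and n: "n \<ge> 1"
  shows "(\<Sum>j. real (Suc j) powr (- c) * damped q N j) \<le>
    (\<Sum>j<n. real (Suc j) powr (2 * q - c)) / real N + real n powr (1 - c) / (c - 1)"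
proof -
  let ?f = "\<lambda>j. real (Suc j) powr (- c) * damped q N j"
  have sm0: "summable (\<lambda>j. real (Suc j) powr (- c))"
    using c summable_real_powr_iff [of "- c"] summable_Suc_iff [of "\<lambda>j. real j powr (- c)"] by simp
  have le: "?f j \<le> real (Suc j) powr (- c)" for j
    using mult_left_mono [OF damped_le_1, of "real (Suc j) powr (- c)" q N j] by simp
  have nn: "0 \<le> ?f j" for j
    using damped_pos [of q N j] by simp
  have sm: "summable ?f"
    by (rule summable_comparison_test' [OF sm0, of 0]) (use le nn in auto)
  have "(\<Sum>j. ?f j) = (\<Sum>j. ?f (j + n)) + (\<Sum>j<n. ?f j)"
    by (rule suminf_split_initial_segment [OF sm])
  also have "(\<Sum>j. ?f (j + n)) \<le> (\<Sum>j. real (Suc (j + n)) powr (- c))"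
    using sm summable_iff_shift [of ?f n] le
    by (intro suminf_le suminf_powr_tail_le [OF c n]) (auto simp del: of_nat_Suc)
  also have "\<dots> \<le> real n powr (1 - c) / (c - 1)"
    by (rule suminf_powr_tail_le [OF c n])
  also have "(\<Sum>j<n. ?f j) \<le> (\<Sum>j<n. real (Suc j) powr (2 * q - c) / real N)"
  proof (rule sum_mono)
    fix j
    have "?f j \<le> real (Suc j) powr (- c) * (real (Suc j) powr (2 * q) / real N)"
      by (intro mult_left_mono damped_le_inverse N) auto
    also have "\<dots> = real (Suc j) powr (2 * q - c) / real N"
      by (simp add: powr_diff powr_minus field_simps del: of_nat_Suc)
    finally show "?f j \<le> real (Suc j) powr (2 * q - c) / real N" .
  qed
  finally show ?thesis by (simp add: sum_divide_distrib)
qed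

text \<open>
  Up to constants, the series is the posterior variance weighted by the test variances. The cut is placed at \<open>N powr (1 / (2 * q))\<close>,
  where \<open>N * Suc j powr (- 2 * q)\<close> crosses \<open>1\<close>. The tail always contributes the first of the three
  expressions in \<open>rate_rho\<close>. The head is a sum of powers with exponent \<open>2 * \<alpha> - 2 * \<alpha>'\<close>, and
  whether this is above, at or below \<open>-1\<close> decides between the three regimes.
\<close>
lemma powr_damped_series_le_rate:
  fixes \<alpha> \<alpha>' p :: real
  assumes q: "\<alpha> + p > 0" and c: "\<alpha>' + p > 1 / 2"
  obtains C where "C \<ge> 0"
    "\<And>N. N \<ge> 3 \<Longrightarrow>
      (\<Sum>j. real (Suc j) powr (- 2 * (\<alpha>' + p)) * damped (\<alpha> + p) N j) \<le> C * rate_rho \<alpha> \<alpha>' p N"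
proof -
  define c where "c = 2 * (\<alpha>' + p)"
  define q where "q = \<alpha> + p"
  have c1: "c > 1" and q0: "q > 0" using assms by (auto simp: c_def q_def)
  define x where "x N = real N powr (1 / (2 * q))" for N :: nat
  define n where "n N = nat \<lceil>x N\<rceil>" for N :: nat
  have x1: "x N \<ge> 1" if "N \<ge> 3" for N
    unfolding x_def using that q0 by (intro ge_one_powr_ge_zero) auto
  have nx: "n N \<ge> 1" "x N \<le> real (n N)" "real (n N) \<le> 2 * x N" if "N \<ge> 3" for N
    using x1 [OF that] unfolding n_def by linarith+
  have split: "(\<Sum>j. real (Suc j) powr (- c) * damped q N j) \<le>
    (\<Sum>j<n N. real (Suc j) powr (2 * q - c)) / real N + x N powr (1 - c) / (c - 1)" if "N \<ge> 3" for N
  proof -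
    have "real (n N) powr (1 - c) \<le> x N powr (1 - c)"
      using nx [OF that] x1 [OF that] c1 by (intro powr_mono2') auto
    then have "real (n N) powr (1 - c) / (c - 1) \<le> x N powr (1 - c) / (c - 1)"
      using c1 by (intro divide_right_mono) auto
    then show ?thesis
      using powr_damped_series_le_split [OF c1 _ nx(1), of N N q] that by force
  qed
  have xc: "x N powr (1 - c) = real N powr (- ((c - 1) / (2 * q)))" for N
    unfolding x_def by (simp add: powr_powr minus_divide_left)
  consider "c < 2 * q + 1" | "c = 2 * q + 1" | "c > 2 * q + 1" by linarith
  then have "\<exists>C\<ge>0. \<forall>N\<ge>3. (\<Sum>j. real (Suc j) powr (- c) * damped q N j) \<le> C * rate_rho \<alpha> \<alpha>' p N"
  proof cases
    case 1
    have rho: "rate_rho \<alpha> \<alpha>' p N = real N powr (- ((c - 1) / (2 * q)))" for N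
    proof -
      have "\<alpha>' < \<alpha> + 1 / 2" using 1 by (simp add: c_def q_def)
      moreover have "1 - (\<alpha> + 1 / 2 - \<alpha>') / (\<alpha> + p) = (c - 1) / (2 * q)"
        using q0 by (simp add: c_def q_def field_simps)
      ultimately show ?thesis unfolding rate_rho_def by simp
    qed
    obtain D where D: "D \<ge> 0" "\<And>n. (\<Sum>j<n. real (Suc j) powr (2 * q - c)) \<le> D * real n powr (2 * q - c + 1)"
      using sum_powr_le_powr [of "2 * q - c"] 1 by auto
    have "(\<Sum>j. real (Suc j) powr (- c) * damped q N j) \<le>
       (D * 2 powr (2 * q - c + 1) + 1 / (c - 1)) * rate_rho \<alpha> \<alpha>' p N" if N: "N \<ge> 3" for N
    proof -
      have "(\<Sum>j<n N. real (Suc j) powr (2 * q - c)) \<le> D * (2 * x N) powr (2 * q - c + 1)"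
        using D(1) nx [OF N] 1
        by (intro order_trans [OF D(2)] mult_left_mono powr_mono2) auto
      also have "\<dots> = D * 2 powr (2 * q - c + 1) * x N powr (2 * q + (1 - c))"
        using x1 [OF N] by (simp add: powr_mult algebra_simps)
      also have "x N powr (2 * q + (1 - c)) = real N * rate_rho \<alpha> \<alpha>' p N"
        using q0 N unfolding rho powr_add xc by (simp add: x_def powr_powr)
      finally have "(\<Sum>j<n N. real (Suc j) powr (2 * q - c)) / real N
          \<le> D * 2 powr (2 * q - c + 1) * rate_rho \<alpha> \<alpha>' p N"
        using N by (simp add: field_simps)
      then show ?thesis using split [OF N] by (simp add: xc rho algebra_simps)
    qed
    then show ?thesis using D(1) c1 by (intro exI [of _ "D * 2 powr (2 * q - c + 1) + 1 / (c - 1)"]) auto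
  next
    case 2
    have rho: "rate_rho \<alpha> \<alpha>' p N = ln (real N) / real N" if "N \<ge> 3" for N
      using 2 that unfolding rate_rho_def by (simp add: c_def q_def powr_minus field_simps)
    have "(\<Sum>j. real (Suc j) powr (- c) * damped q N j) \<le>
       (2 + 1 / (2 * q) + 1 / (c - 1)) * rate_rho \<alpha> \<alpha>' p N" if N: "N \<ge> 3" for N
    proof -
      have ln1: "1 \<le> ln (real N)"
        using exp_le N by (subst ln_ge_iff) auto
      have "(\<Sum>j<n N. real (Suc j) powr (2 * q - c)) = (\<Sum>j<n N. 1 / real (Suc j))"
        using 2 by (intro sum.cong) (auto simp: powr_minus field_simps)
      also have "\<dots> \<le> 1 + ln (2 * x N)"
        using nx [OF N] by (intro order_trans [OF harmonic_sum_le]) auto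
      also have "\<dots> = 1 + ln 2 + ln (real N) / (2 * q)"
        using N x1 [OF N] by (simp add: ln_mult x_def ln_powr)
      also have "\<dots> \<le> (2 + 1 / (2 * q)) * ln (real N)"
        using ln_le_minus_one [of 2] ln1 q0 by (simp add: algebra_simps)
      finally have "(\<Sum>j<n N. real (Suc j) powr (2 * q - c)) / real N
          \<le> (2 + 1 / (2 * q)) * rate_rho \<alpha> \<alpha>' p N"
        using N by (simp add: rho field_simps)
      moreover have "x N powr (1 - c) \<le> rate_rho \<alpha> \<alpha>' p N"
        using 2 q0 N ln1 unfolding xc by (simp add: rho powr_minus field_simps)
      then have "x N powr (1 - c) / (c - 1) \<le> 1 / (c - 1) * rate_rho \<alpha> \<alpha>' p N"
        using c1 by (simp add: divide_right_mono)
      ultimately show ?thesis using split [OF N] by (simp add: algebra_simps)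
    qed
    then show ?thesis using q0 c1 by (intro exI [of _ "2 + 1 / (2 * q) + 1 / (c - 1)"]) auto
  next
    case 3
    have rho: "rate_rho \<alpha> \<alpha>' p N = 1 / real N" if "N \<ge> 3" for N
      using 3 that unfolding rate_rho_def by (simp add: c_def q_def powr_minus field_simps)
    have sm: "summable (\<lambda>j. real (Suc j) powr (2 * q - c))"
      using 3 summable_real_powr_iff [of "2 * q - c"] summable_Suc_iff [of "\<lambda>j. real j powr (2 * q - c)"]
      by simp
    have "(\<Sum>j. real (Suc j) powr (- c) * damped q N j) \<le>
       ((\<Sum>j. real (Suc j) powr (2 * q - c)) + 1 / (c - 1)) * rate_rho \<alpha> \<alpha>' p N" if N: "N \<ge> 3" for N
    proof -
      have "(\<Sum>j<n N. real (Suc j) powr (2 * q - c)) / real N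
          \<le> (\<Sum>j. real (Suc j) powr (2 * q - c)) / real N"
        by (intro divide_right_mono sum_le_suminf sm) auto
      moreover have "real N powr (- ((c - 1) / (2 * q))) \<le> real N powr (- 1)"
        using 3 q0 N by (intro powr_mono) (auto simp: field_simps)
      then have "x N powr (1 - c) \<le> rate_rho \<alpha> \<alpha>' p N"
        using N by (simp add: xc rho powr_minus field_simps)
      then have "x N powr (1 - c) / (c - 1) \<le> 1 / (c - 1) * rate_rho \<alpha> \<alpha>' p N"
        using c1 by (simp add: divide_right_mono)
      ultimately show ?thesis using split [OF N] by (simp add: rho [OF N] algebra_simps)
    qed
    moreover have "(\<Sum>j. real (Suc j) powr (2 * q - c)) \<ge> 0" by (intro suminf_nonneg sm) auto
    ultimately show ?thesis using c1
      by (intro exI [of _ "(\<Sum>j. real (Suc j) powr (2 * q - c)) + 1 / (c - 1)"]) auto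
  qed
  then show ?thesis using that unfolding c_def q_def by auto
qed

text \<open>
  Multiplied by the inverse of the rate, the series becomes \<open>\<Sum>j. w j * (y powr \<theta> / (1 + y))\<close>
  with summable weights \<open>w j = Suc j powr (2 * s) * (l j)\<^sup>2\<close> and \<open>y = N * Suc j powr (- 2 * q)\<close>.
  For \<open>0 < \<theta> < 1\<close> the second factor is bounded by \<open>1\<close> and tends to \<open>0\<close> for each fixed \<open>j\<close>,
  so dominated convergence for series applies; it gives a little-o and no explicit rate.
\<close>
lemma sobolev_damped_series_smallo:
  fixes a s q :: real
  assumes l: "l \<in> sobolev_seq s" and as: "a + s > 0" and q: "q > 0" and sat: "a + s < q"
  shows "(\<lambda>N. \<Sum>j. real (Suc j) powr (- 2 * a) * (l j)\<^sup>2 * damped q N j)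
           \<in> o(\<lambda>N. real N powr (- (a + s) / q))"
proof -
  define \<theta> where "\<theta> = (a + s) / q"
  have th: "0 < \<theta>" "\<theta> < 1" using as q sat by (auto simp: \<theta>_def)
  define w where "w = (\<lambda>j. real (Suc j) powr (2 * s) * (l j)\<^sup>2)"
  define y where "y N j = real N * real (Suc j) powr (- 2 * q)" for N j :: nat
  define f where "f j N = w j * (y N j powr \<theta> / (1 + y N j))" for j N :: nat
  have w: "summable w" "\<And>j. w j \<ge> 0" using l by (auto simp: sobolev_seq_def w_def)
  have y0: "y N j \<ge> 0" for N j by (simp add: y_def)
  have y_le: "y N j powr \<theta> / (1 + y N j) \<le> 1" for N j
  proof (cases "y N j \<le> 1")
    case True
    then have "y N j powr \<theta> \<le> 1" using th y0 by (intro powr_le1) auto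
    then show ?thesis using y0 [of N j] by (simp add: divide_le_eq)
  next
    case False
    then have "y N j powr \<theta> \<le> y N j powr 1" using th by (intro powr_mono) auto
    then show ?thesis using False by (simp add: divide_le_eq)
  qed
  have f_eq: "real N powr \<theta> * (real (Suc j) powr (- 2 * a) * (l j)\<^sup>2 * damped q N j) = f j N" for j N
  proof -
    have "(- 2 * q) * \<theta> = - 2 * a - 2 * s"
      using q by (simp add: \<theta>_def field_simps)
    then have "y N j powr \<theta> = real N powr \<theta> * (real (Suc j) powr (- 2 * a) / real (Suc j) powr (2 * s))"
      unfolding y_def by (subst powr_mult) (simp_all only: powr_powr powr_diff)
    then show ?thesis
      unfolding f_def w_def damped_def y_def [symmetric] by (simp add: field_simps del: of_nat_Suc)
  qed
  have lim: "(\<lambda>N. f j N) \<longlonglongrightarrow> 0" for j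
  proof -
    have pos: "0 < real (Suc j) powr (- 2 * q)" by simp
    have "filterlim (\<lambda>N. y N j) at_top sequentially"
      unfolding y_def using pos
      by (intro filterlim_at_top_mult_tendsto_pos [OF tendsto_const] filterlim_real_sequentially)
         (auto simp: mult.commute)
    moreover have "((\<lambda>t. t powr \<theta> / (1 + t)) \<longlongrightarrow> 0) at_top"
      using th by real_asymp
    ultimately have "(\<lambda>N. y N j powr \<theta> / (1 + y N j)) \<longlonglongrightarrow> 0"
      by (rule filterlim_compose [rotated])
    then show ?thesis unfolding f_def by (rule tendsto_mult_right_zero)
  qed
  have "((\<lambda>N. \<Sum>j. f j N) \<longlongrightarrow> (\<Sum>j. 0)) sequentially"
  proof (intro conjunct2 [OF conjunct2 [OF tannerys_theorem]] lim)
    have "norm (f j N) \<le> w j" for j N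
      using mult_left_mono [OF y_le w(2)] w(2) [of j] y0 [of N j] by (simp add: f_def abs_mult)
    then show "\<forall>\<^sub>F (j, N) in sequentially \<times>\<^sub>F sequentially. norm (f j N) \<le> w j"
      by (intro always_eventually) auto
  qed (use w in auto)
  then have L: "(\<lambda>N. \<Sum>j. f j N) \<longlonglongrightarrow> 0" by simp
  let ?g = "\<lambda>N j. real (Suc j) powr (- 2 * a) * (l j)\<^sup>2 * damped q N j"
  show ?thesis
  proof (rule smalloI_tendsto)
    have "(\<Sum>j. f j N) = (\<Sum>j. ?g N j) / real N powr (- (a + s) / q)" if "N \<ge> 1" for N
    proof -
      have sm: "summable (\<lambda>j. f j N)"
      proof (rule summable_comparison_test' [OF w(1), of 0])
        show "norm (f j N) \<le> w j" for j
          using mult_left_mono [OF y_le w(2)] w(2) [of j] y0 [of N j] by (simp add: f_def abs_mult)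
      qed
      have "?g N j = f j N * real N powr (- \<theta>)" for j
        using f_eq [of N j] that by (simp add: powr_minus field_simps)
      then have "(\<Sum>j. ?g N j) = (\<Sum>j. f j N) * real N powr (- \<theta>)"
        using suminf_mult2 [OF sm, of "real N powr (- \<theta>)"] by simp
      then show ?thesis using that by (simp add: \<theta>_def minus_divide_left)
    qed
    then have "\<forall>\<^sub>F N in sequentially. (\<Sum>j. f j N) = (\<Sum>j. ?g N j) / real N powr (- (a + s) / q)"
      using eventually_ge_at_top by (rule eventually_mono [rotated]) auto
    then show "(\<lambda>N. (\<Sum>j. ?g N j) / real N powr (- (a + s) / q)) \<longlonglongrightarrow> 0"
      using L by (rule Lim_transform_eventually [rotated])
    show "\<forall>\<^sub>F N in sequentially. real N powr (- (a + s) / q) \<noteq> 0"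
      using eventually_gt_at_top [of 0] by eventually_elim auto
  qed
qed

text \<open>
  When \<open>a + s \<ge> q\<close> the squared bias of each coordinate decays like \<open>1 / N\<close> already after bounding
  the squared damping by its first power, and the Sobolev weights are summable enough to add these
  bounds. The term \<open>C / N\<close> never exceeds the order of \<open>rate_rho\<close>, so \<open>r\<close> may then be \<open>0\<close>.
\<close>
lemma sobolev_damped_series_le:
  fixes a s q :: real
  assumes l: "l \<in> sobolev_seq s" and as: "a + s > 0" and q: "q > 0"
  obtains r C where "\<And>N. r N \<ge> 0" "r \<in> o(\<lambda>N. real N powr (- (a + s) / q))" "C \<ge> 0"
    "\<And>N. N \<ge> 1 \<Longrightarrow>
      (\<Sum>j. real (Suc j) powr (- 2 * a) * (l j)\<^sup>2 * damped q N j) \<le> r N + C / real N"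
proof -
  define w where "w = (\<lambda>j. real (Suc j) powr (2 * s) * (l j)\<^sup>2)"
  have w: "summable w" "\<And>j. w j \<ge> 0" using l by (auto simp: sobolev_seq_def w_def)
  let ?g = "\<lambda>N j. real (Suc j) powr (- 2 * a) * (l j)\<^sup>2 * damped q N j"
  have g0: "0 \<le> ?g N j" for N j using damped_pos [of q N j] by simp
  have g1: "?g N j \<le> w j" for N j
  proof -
    have "?g N j \<le> real (Suc j) powr (- 2 * a) * (l j)\<^sup>2 * 1"
      by (intro mult_left_mono damped_le_1) auto
    also have "\<dots> \<le> w j"
      unfolding w_def using as by (auto intro!: mult_right_mono powr_mono)
    finally show ?thesis .
  qed
  have sm: "summable (?g N)" for N
    by (rule summable_comparison_test' [OF w(1), of 0]) (use g0 g1 in auto)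
  have nonneg: "0 \<le> suminf (?g N)" for N
    by (rule suminf_nonneg [OF sm g0])
  show thesis
  proof (cases "a + s < q")
    case True
    show thesis
      by (rule that [OF nonneg sobolev_damped_series_smallo [OF l as q True], of 0]) auto
  next
    case False
    show thesis
    proof (rule that [of "\<lambda>_. 0" "suminf w"])
      show "suminf w \<ge> 0" by (intro suminf_nonneg w)
      fix N :: nat assume N: "N \<ge> 1"
      have "?g N j \<le> w j / real N" for j
      proof -
        have "?g N j \<le> real (Suc j) powr (- 2 * a) * (l j)\<^sup>2 * (real (Suc j) powr (2 * q) / real N)"
          using N by (intro mult_left_mono damped_le_inverse) auto
        also have "\<dots> = real (Suc j) powr (2 * q - 2 * a) * (l j)\<^sup>2 / real N"
          by (simp add: powr_diff powr_minus field_simps del: of_nat_Suc)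
        also have "\<dots> \<le> w j / real N"
          unfolding w_def using False by (auto intro!: divide_right_mono mult_right_mono powr_mono)
        finally show ?thesis .
      qed
      then have "suminf (?g N) \<le> (\<Sum>j. w j / real N)"
        by (intro suminf_le sm summable_divide w)
      then show "suminf (?g N) \<le> 0 + suminf w / real N"
        by (simp add: suminf_divide [OF w(1)])
    qed auto
  qed
qed

text \<open>
  The parametric rate is a lower bound for \<open>rate_rho\<close> in all regimes, so terms of order \<open>1 / N\<close> can be
  absorbed. From \<open>N = 3\<close> on, \<open>ln N \<ge> 1\<close>.
\<close>
lemma rate_rho_ge_inverse:
  assumes "\<alpha> + p > 0" "N \<ge> 3"
  shows "1 / real N \<le> rate_rho \<alpha> \<alpha>' p N"
proof -
  have N1: "1 / real N = real N powr (- 1)" using assms by (simp add: powr_minus field_simps)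
  consider "\<alpha>' < \<alpha> + 1/2" | "\<alpha>' = \<alpha> + 1/2" | "\<alpha>' > \<alpha> + 1/2" by linarith
  then show ?thesis
  proof cases
    case 1
    have "real N powr (- 1) \<le> real N powr (- (1 - (\<alpha> + 1/2 - \<alpha>') / (\<alpha> + p)))"
      using 1 assms by (intro powr_mono) auto
    then show ?thesis unfolding N1 rate_rho_def using 1 by simp
  next
    case 2
    have "1 \<le> ln (real N)" using exp_le assms by (subst ln_ge_iff) auto
    then have "real N powr (- 1) * 1 \<le> real N powr (- 1) * ln (real N)"
      by (intro mult_left_mono) auto
    then show ?thesis unfolding N1 rate_rho_def using 2 by simp
  next
    case 3
    then show ?thesis unfolding N1 rate_rho_def by simp
  qed
qed

lemma rate_rho_tendsto_0:
  assumes "\<alpha> + p > 0" "\<alpha>' + p > 1 / 2"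
  shows "rate_rho \<alpha> \<alpha>' p \<longlonglongrightarrow> 0"
proof -
  have neg: "(\<lambda>N. real N powr b) \<longlonglongrightarrow> 0" if "b < 0" for b
    using tendsto_neg_powr [OF that filterlim_real_sequentially] .
  consider "\<alpha>' < \<alpha> + 1/2" | "\<alpha>' = \<alpha> + 1/2" | "\<alpha>' > \<alpha> + 1/2" by linarith
  then show ?thesis
  proof cases
    case 1
    have "- (1 - (\<alpha> + 1/2 - \<alpha>') / (\<alpha> + p)) < 0"
      using assms by (simp add: field_simps)
    from neg [OF this] show ?thesis using 1 by (simp add: rate_rho_def [abs_def])
  next
    case 2
    have "((\<lambda>x::real. x powr (-1) * ln x) \<longlongrightarrow> 0) at_top" by real_asymp
    then have "(\<lambda>N. real N powr (-1) * ln (real N)) \<longlonglongrightarrow> 0"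
      by (rule filterlim_compose [OF _ filterlim_real_sequentially])
    then show ?thesis using 2 by (simp add: rate_rho_def [abs_def])
  next
    case 3
    then show ?thesis using neg [of "- 1"] by (simp add: rate_rho_def [abs_def])
  qed
qed

section \<open>Moments of sums of independent variables\<close>

lemma (in finite_measure) integrable_power_of_fourth:
  fixes X :: "'a \<Rightarrow> real"
  assumes [measurable]: "X \<in> borel_measurable M" and X4: "integrable M (\<lambda>x. X x ^ 4)" and "k \<le> 4"
  shows "integrable M (\<lambda>x. X x ^ k)"
proof (rule Bochner_Integration.integrable_bound)
  show "integrable M (\<lambda>x. 1 + X x ^ 4)" using X4 by auto
  have "\<bar>y\<bar> ^ k \<le> 1 + y ^ 4" for y :: real
  proof (cases "\<bar>y\<bar> \<le> 1")
    case True
    then have "\<bar>y\<bar> ^ k \<le> 1" by (intro power_le_one) auto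
    then show ?thesis using zero_le_even_power [of 4 y] by (simp add: add_increasing2)
  next
    case False
    then have "\<bar>y\<bar> ^ k \<le> \<bar>y\<bar> ^ 4" using assms by (intro power_increasing) auto
    then show ?thesis by (simp add: power_even_abs)
  qed
  then have "norm (X x ^ k) \<le> norm (1 + X x ^ 4)" for x
    unfolding real_norm_def power_abs by (rule order_trans) (rule abs_ge_self)
  then show "AE x in M. norm (X x ^ k) \<le> norm (1 + X x ^ 4)" by simp
qed simp

lemma (in prob_space) second_moment_indep_sum:
  fixes Z :: "'i \<Rightarrow> 'a \<Rightarrow> real"
  assumes "finite I" "indep_vars (\<lambda>_. borel) Z I"
    and "\<And>i. i \<in> I \<Longrightarrow> integrable M (\<lambda>x. (Z i x)\<^sup>2)"
    and "\<And>i. i \<in> I \<Longrightarrow> expectation (Z i) = 0"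
  shows "integrable M (\<lambda>x. (\<Sum>i\<in>I. Z i x)\<^sup>2)"
    and "expectation (\<lambda>x. (\<Sum>i\<in>I. Z i x)\<^sup>2) = (\<Sum>i\<in>I. expectation (\<lambda>x. (Z i x)\<^sup>2))"
    and "integrable M (\<lambda>x. \<Sum>i\<in>I. Z i x)"
    and "expectation (\<lambda>x. \<Sum>i\<in>I. Z i x) = 0"
proof -
  have "integrable M (\<lambda>x. (\<Sum>i\<in>I. Z i x)\<^sup>2) \<and>
    expectation (\<lambda>x. (\<Sum>i\<in>I. Z i x)\<^sup>2) = (\<Sum>i\<in>I. expectation (\<lambda>x. (Z i x)\<^sup>2)) \<and>
    integrable M (\<lambda>x. \<Sum>i\<in>I. Z i x) \<and> expectation (\<lambda>x. \<Sum>i\<in>I. Z i x) = 0"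
    using assms
  proof (induction I rule: finite_induct)
    case (insert i F)
    define S where "S x = (\<Sum>i\<in>F. Z i x)" for x
    have ind: "indep_var borel (Z i) borel S"
      unfolding S_def by (rule indep_vars_sum) (use insert in auto)
    have IH: "integrable M (\<lambda>x. (S x)\<^sup>2)"
      "expectation (\<lambda>x. (S x)\<^sup>2) = (\<Sum>i\<in>F. expectation (\<lambda>x. (Z i x)\<^sup>2))"
      "integrable M S" "expectation S = 0"
      using insert.IH insert.prems indep_vars_subset [OF insert.prems(1), of F]
      unfolding S_def by auto
    have Zm: "Z i \<in> borel_measurable M" using indep_var_rv1 [OF ind] by simp
    have Z2: "integrable M (\<lambda>x. (Z i x)\<^sup>2)" "expectation (Z i) = 0" using insert.prems by auto
    have Z1: "integrable M (Z i)" by (rule square_integrable_imp_integrable [OF Zm Z2(1)])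
    have ZS: "integrable M (\<lambda>x. Z i x * S x)" "expectation (\<lambda>x. Z i x * S x) = 0"
      using indep_var_integrable [OF ind Z1 IH(3)] indep_var_lebesgue_integral [OF ind Z1 IH(3)] Z2 by auto
    have sum: "(\<Sum>i\<in>insert i F. Z i x) = Z i x + S x" for x
      unfolding S_def using insert.hyps by simp
    have sq: "(Z i x + S x)\<^sup>2 = (Z i x)\<^sup>2 + (S x)\<^sup>2 + 2 * (Z i x * S x)" for x
      by (simp add: power2_sum)
    show ?case
      unfolding sum sq using Z1 Z2 ZS IH insert.hyps by simp
  qed auto
  then show "integrable M (\<lambda>x. (\<Sum>i\<in>I. Z i x)\<^sup>2)"
    "expectation (\<lambda>x. (\<Sum>i\<in>I. Z i x)\<^sup>2) = (\<Sum>i\<in>I. expectation (\<lambda>x. (Z i x)\<^sup>2))"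
    "integrable M (\<lambda>x. \<Sum>i\<in>I. Z i x)"
    "expectation (\<lambda>x. \<Sum>i\<in>I. Z i x) = 0" by auto
qed

text \<open>
  The odd cross terms vanish by independence and centering, and the term \<open>6 * v * V\<close> left over
  is absorbed by \<open>2 * K * v * V\<close>; this is where \<open>K \<ge> 3\<close>, the Gaussian kurtosis, comes from.
\<close>
lemma (in prob_space) fourth_moment_indep_sum:
  fixes Z :: "'i \<Rightarrow> 'a \<Rightarrow> real"
  assumes "finite I" "indep_vars (\<lambda>_. borel) Z I" and K: "K \<ge> 3"
    and "\<And>i. i \<in> I \<Longrightarrow> integrable M (\<lambda>x. Z i x ^ 4)"
    and "\<And>i. i \<in> I \<Longrightarrow> expectation (Z i) = 0"
    and "\<And>i. i \<in> I \<Longrightarrow> expectation (\<lambda>x. Z i x ^ 4) \<le> K * (expectation (\<lambda>x. (Z i x)\<^sup>2))\<^sup>2"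
  shows "integrable M (\<lambda>x. (\<Sum>i\<in>I. Z i x) ^ 4)"
    and "expectation (\<lambda>x. (\<Sum>i\<in>I. Z i x) ^ 4) \<le> K * (\<Sum>i\<in>I. expectation (\<lambda>x. (Z i x)\<^sup>2))\<^sup>2"
proof -
  have "integrable M (\<lambda>x. (\<Sum>i\<in>I. Z i x) ^ 4) \<and>
    expectation (\<lambda>x. (\<Sum>i\<in>I. Z i x) ^ 4) \<le> K * (\<Sum>i\<in>I. expectation (\<lambda>x. (Z i x)\<^sup>2))\<^sup>2"
    using assms(1,2,4-)
  proof (induction I rule: finite_induct)
    case (insert i F)
    define S where "S x = (\<Sum>i\<in>F. Z i x)" for x
    have indF: "indep_vars (\<lambda>_. borel) Z F"
      by (rule indep_vars_subset [OF insert.prems(1)]) auto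
    have ind: "indep_var borel (Z i) borel S"
      unfolding S_def by (rule indep_vars_sum) (use insert in auto)
    have Zm: "Z i \<in> borel_measurable M" and Sm: "S \<in> borel_measurable M"
      using indep_var_rv1 [OF ind] indep_var_rv2 [OF ind] by simp_all
    have rv: "Z k \<in> borel_measurable M" if "k \<in> F" for k
      using indF that by (auto simp: indep_vars_def)
    have sq: "integrable M (\<lambda>x. (Z k x)\<^sup>2)" if "k \<in> F" for k
      using integrable_power_of_fourth [OF rv [OF that] insert.prems(2), of 2] that by auto
    have IH: "integrable M (\<lambda>x. S x ^ 4)"
      "expectation (\<lambda>x. S x ^ 4) \<le> K * (\<Sum>i\<in>F. expectation (\<lambda>x. (Z i x)\<^sup>2))\<^sup>2"
      using insert.IH [OF indF] insert.prems unfolding S_def by auto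
    have S2: "expectation (\<lambda>x. (S x)\<^sup>2) = (\<Sum>i\<in>F. expectation (\<lambda>x. (Z i x)\<^sup>2))" "expectation S = 0"
      using second_moment_indep_sum [OF insert.hyps(1) indF sq] insert.prems(3)
      unfolding S_def by auto
    have Z4: "integrable M (\<lambda>x. Z i x ^ 4)" "expectation (Z i) = 0"
      "expectation (\<lambda>x. Z i x ^ 4) \<le> K * (expectation (\<lambda>x. (Z i x)\<^sup>2))\<^sup>2"
      using insert.prems by auto
    have Zk: "integrable M (\<lambda>x. Z i x ^ k)" if "k \<le> 4" for k
      by (rule integrable_power_of_fourth [OF Zm Z4(1) that])
    have Sk: "integrable M (\<lambda>x. S x ^ k)" if "k \<le> 4" for k
      by (rule integrable_power_of_fourth [OF Sm IH(1) that])
    have cross: "integrable M (\<lambda>x. Z i x ^ a * S x ^ b)"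
      "expectation (\<lambda>x. Z i x ^ a * S x ^ b) = expectation (\<lambda>x. Z i x ^ a) * expectation (\<lambda>x. S x ^ b)"
      if "a \<le> 4" "b \<le> 4" for a b
    proof -
      have i: "indep_var borel (\<lambda>x. Z i x ^ a) borel (\<lambda>x. S x ^ b)"
        using indep_var_compose [OF ind, of "\<lambda>y. y ^ a" borel "\<lambda>y. y ^ b" borel] by (simp add: comp_def)
      show "integrable M (\<lambda>x. Z i x ^ a * S x ^ b)"
        "expectation (\<lambda>x. Z i x ^ a * S x ^ b) = expectation (\<lambda>x. Z i x ^ a) * expectation (\<lambda>x. S x ^ b)"
        using indep_var_integrable [OF i] indep_var_lebesgue_integral [OF i] Zk Sk that by auto
    qed
    have sum: "(\<Sum>i\<in>insert i F. Z i x) = Z i x + S x" for x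
      unfolding S_def using insert.hyps by simp
    have ex: "(Z i x + S x) ^ 4 = Z i x ^ 4 + 4 * (Z i x ^ 3 * S x ^ 1) + 6 * (Z i x ^ 2 * S x ^ 2)
        + 4 * (Z i x ^ 1 * S x ^ 3) + S x ^ 4" for x
      by (simp add: power4_eq_xxxx power3_eq_cube power2_eq_square algebra_simps)
    note [simp] = cross [of 3 1, simplified] cross [of 2 2, simplified] cross [of 1 3, simplified]
    define v where "v = expectation (\<lambda>x. (Z i x)\<^sup>2)"
    define V where "V = expectation (\<lambda>x. (S x)\<^sup>2)"
    have vV: "v \<ge> 0" "V \<ge> 0" unfolding v_def V_def by simp_all
    have "integrable M (\<lambda>x. (Z i x + S x) ^ 4)"
      unfolding ex using Z4 IH by simp
    moreover have "expectation (\<lambda>x. (Z i x + S x) ^ 4) =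
        expectation (\<lambda>x. Z i x ^ 4) + 6 * (v * V) + expectation (\<lambda>x. S x ^ 4)"
      unfolding ex v_def V_def using Z4 IH S2 by simp
    moreover have "\<dots> \<le> K * v\<^sup>2 + 6 * (v * V) + K * V\<^sup>2"
      using Z4(3) IH(2) by (simp add: v_def V_def S2)
    moreover have "6 * (v * V) \<le> (2 * K) * (v * V)"
      using K vV by (intro mult_right_mono) auto
    moreover have "K * v\<^sup>2 + (2 * K) * (v * V) + K * V\<^sup>2 = K * (v + V)\<^sup>2"
      by (simp add: power2_eq_square algebra_simps)
    ultimately show ?case
      unfolding sum using insert.hyps by (simp add: v_def V_def S2)
  qed auto
  then show "integrable M (\<lambda>x. (\<Sum>i\<in>I. Z i x) ^ 4)"
    "expectation (\<lambda>x. (\<Sum>i\<in>I. Z i x) ^ 4) \<le> K * (\<Sum>i\<in>I. expectation (\<lambda>x. (Z i x)\<^sup>2))\<^sup>2" by auto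
qed

section \<open>Concentration of the empirical variances\<close>

text \<open>
  Every marginal \<open>h \<bullet> x\<close> has kurtosis at most \<open>K\<close>, with \<open>K\<close> independent of \<open>h\<close>: the partial sums of the
  Karhunen-Loeve expansion are sums of independent variables whose kurtosis is uniformly bounded, and
  Fatou's lemma passes to the limit. The uniformity in \<open>h\<close> is what makes all later bounds hold for
  all coordinates simultaneously.
\<close>
lemma fourth_moment_marginal:
  fixes \<phi> :: "nat \<Rightarrow> 'h::{real_inner,banach,second_countable_topology}"
  assumes T: "training_distribution \<phi> \<nu> \<Lambda>" and M: "assumption_M \<phi> \<nu> \<Lambda>"
  obtains K where "K \<ge> 3"
    "\<And>h. (\<integral>\<^sup>+x. ennreal ((h \<bullet> x) ^ 4) \<partial>\<nu>) \<le> ennreal (K * (h \<bullet> \<Lambda> h)\<^sup>2)"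
proof -
  from T interpret prob_space \<nu> by (simp add: training_distribution_def)
  have sets [measurable_cong]: "sets \<nu> = sets borel"
    and cov: "\<And>h k. (\<integral>x. (h \<bullet> x) * (k \<bullet> x) \<partial>\<nu>) = h \<bullet> \<Lambda> k"
    and lin: "bounded_linear \<Lambda>"
    using T by (auto simp: training_distribution_def)
  have sym: "h \<bullet> \<Lambda> k = k \<bullet> \<Lambda> h" for h k
    unfolding cov [symmetric] by (simp add: mult.commute)
  have pos: "0 \<le> h \<bullet> \<Lambda> h" for h
    unfolding cov [symmetric] by simp
  from M obtain e :: "nat \<Rightarrow> 'h" and lam and \<zeta> :: "nat \<Rightarrow> 'h \<Rightarrow> real" where
    e: "orthonormal_basis e" and eig: "\<And>k. \<Lambda> (e k) = (lam k)\<^sup>2 *\<^sub>R e k" and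
    KL: "AE x in \<nu>. (\<lambda>k. (lam k * \<zeta> k x) *\<^sub>R e k) sums x" and
    ind: "indep_vars (\<lambda>_. borel) \<zeta> UNIV" and
    int4: "\<And>k. integrable \<nu> (\<lambda>x. (\<zeta> k x) ^ 4)" and
    mean: "\<And>k. expectation (\<zeta> k) = 0" and var: "\<And>k. expectation (\<lambda>x. (\<zeta> k x)\<^sup>2) = 1" and
    bigo: "(\<lambda>k. expectation (\<lambda>x. (\<zeta> k x) ^ 4)) \<in> O(\<lambda>_. 1)"
    unfolding assumption_M_def by blast
  obtain C where C: "\<And>k. \<bar>expectation (\<lambda>x. (\<zeta> k x) ^ 4)\<bar> \<le> C"
    using bigo_pointwise_bound [OF bigo] by auto
  define K where "K = max 3 C"
  have K: "K \<ge> 3" "\<And>k. expectation (\<lambda>x. (\<zeta> k x) ^ 4) \<le> K"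
    using C by (auto simp: K_def abs_le_iff le_max_iff_disj)
  have on: "e i \<bullet> e j = (if i = j then 1 else 0)" for i j
    using e by (simp add: orthonormal_basis_def)
  have "(\<integral>\<^sup>+x. ennreal ((h \<bullet> x) ^ 4) \<partial>\<nu>) \<le> ennreal (K * (h \<bullet> \<Lambda> h)\<^sup>2)" for h
  proof -
    define c where "c k = h \<bullet> e k" for k
    define Z where "Z k x = c k * lam k * \<zeta> k x" for k x
    define S where "S n x = (\<Sum>k<n. Z k x)" for n x
    have indZ: "indep_vars (\<lambda>_. borel) Z {..<n}" for n
      unfolding Z_def
      by (rule indep_vars_compose2 [OF indep_vars_subset [OF ind]]) auto
    have Z2: "expectation (\<lambda>x. (Z k x)\<^sup>2) = (c k)\<^sup>2 * (lam k)\<^sup>2" for k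
      unfolding Z_def by (simp add: power_mult_distrib var)
    have Z4: "expectation (\<lambda>x. Z k x ^ 4) \<le> K * (expectation (\<lambda>x. (Z k x)\<^sup>2))\<^sup>2" for k
    proof -
      have "expectation (\<lambda>x. Z k x ^ 4) = (c k * lam k) ^ 4 * expectation (\<lambda>x. (\<zeta> k x) ^ 4)"
        unfolding Z_def by (simp add: power_mult_distrib)
      also have "\<dots> \<le> (c k * lam k) ^ 4 * K"
        using K(2) [of k] by (intro mult_left_mono) auto
      also have "\<dots> = K * (expectation (\<lambda>x. (Z k x)\<^sup>2))\<^sup>2"
        unfolding Z2 by (simp add: power_mult_distrib flip: power_mult)
      finally show ?thesis .
    qed
    have Z4i: "integrable \<nu> (\<lambda>x. Z k x ^ 4)" for k
      unfolding Z_def using int4 [of k] by (simp add: power_mult_distrib)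
    have Zmean: "expectation (Z k) = 0" for k
      unfolding Z_def using mean [of k] by simp
    have partial: "(\<Sum>k<n. (c k)\<^sup>2 * (lam k)\<^sup>2) \<le> h \<bullet> \<Lambda> h" for n
    proof -
      \<comment> \<open>Bessel inequality for the form of \<open>\<Lambda>\<close>: positivity is applied to \<open>h\<close> minus its projection.\<close>
      define u where "u = (\<Sum>k<n. c k *\<^sub>R e k)"
      have \<Lambda>u: "\<Lambda> u = (\<Sum>k<n. (c k * (lam k)\<^sup>2) *\<^sub>R e k)"
        unfolding u_def using lin
        by (simp add: linear_sum [OF bounded_linear.linear] linear_cmul [OF bounded_linear.linear] eig)
      have 1: "h \<bullet> \<Lambda> u = (\<Sum>k<n. (c k)\<^sup>2 * (lam k)\<^sup>2)"
        unfolding \<Lambda>u by (simp add: inner_sum_right c_def power2_eq_square algebra_simps)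
      have 2: "u \<bullet> \<Lambda> u = (\<Sum>k<n. (c k)\<^sup>2 * (lam k)\<^sup>2)"
        unfolding \<Lambda>u unfolding u_def
        by (simp add: inner_sum_right inner_sum_left on sum.delta if_distrib power2_eq_square mult_ac cong: if_cong)
      have "0 \<le> (h - u) \<bullet> \<Lambda> (h - u)" by (rule pos)
      also have "\<Lambda> (h - u) = \<Lambda> h - \<Lambda> u" using lin by (simp add: linear_diff bounded_linear.linear)
      also have "(h - u) \<bullet> (\<Lambda> h - \<Lambda> u) = h \<bullet> \<Lambda> h - h \<bullet> \<Lambda> u - u \<bullet> \<Lambda> h + u \<bullet> \<Lambda> u"
        by (simp add: inner_diff_left inner_diff_right)
      finally show ?thesis using 1 2 sym [of u h] by simp
    qed
    have S4: "(\<integral>\<^sup>+x. ennreal (S n x ^ 4) \<partial>\<nu>) \<le> ennreal (K * (h \<bullet> \<Lambda> h)\<^sup>2)" for n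
    proof -
      have I: "integrable \<nu> (\<lambda>x. S n x ^ 4)"
        and E: "expectation (\<lambda>x. S n x ^ 4) \<le> K * (\<Sum>k<n. expectation (\<lambda>x. (Z k x)\<^sup>2))\<^sup>2"
        unfolding S_def
        using fourth_moment_indep_sum [OF _ indZ [of n] K(1) Z4i Zmean Z4] by auto
      have "(\<integral>\<^sup>+x. ennreal (S n x ^ 4) \<partial>\<nu>) = ennreal (expectation (\<lambda>x. S n x ^ 4))"
        by (rule nn_integral_eq_integral [OF I]) auto
      also have "expectation (\<lambda>x. S n x ^ 4) \<le> K * (h \<bullet> \<Lambda> h)\<^sup>2"
        unfolding Z2 using E partial [of n] K(1)
        by (intro order_trans [OF E] mult_left_mono power_mono) (auto simp: Z2 sum_nonneg)
      finally show ?thesis by (simp add: ennreal_leI)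
    qed
    have [measurable]: "\<zeta> k \<in> borel_measurable \<nu>" for k
      using ind by (simp add: indep_vars_def)
    have Sm: "S n \<in> borel_measurable \<nu>" for n
      unfolding S_def Z_def by measurable
    have lim: "AE x in \<nu>. (\<lambda>n. ennreal (S n x ^ 4)) \<longlonglongrightarrow> ennreal ((h \<bullet> x) ^ 4)"
      using KL
    proof eventually_elim
      case (elim x)
      have "(\<lambda>k. h \<bullet> ((lam k * \<zeta> k x) *\<^sub>R e k)) sums (h \<bullet> x)"
        by (rule bounded_linear.sums [OF bounded_linear_inner_right elim])
      then have "(\<lambda>n. S n x) \<longlonglongrightarrow> h \<bullet> x"
        by (simp add: sums_def S_def Z_def c_def mult_ac)
      then show ?case by (intro tendsto_ennrealI tendsto_power)
    qed
    have "(\<integral>\<^sup>+x. ennreal ((h \<bullet> x) ^ 4) \<partial>\<nu>) = (\<integral>\<^sup>+x. liminf (\<lambda>n. ennreal (S n x ^ 4)) \<partial>\<nu>)"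
    proof (rule nn_integral_cong_AE)
      show "AE x in \<nu>. ennreal ((h \<bullet> x) ^ 4) = liminf (\<lambda>n. ennreal (S n x ^ 4))"
        using lim by eventually_elim (rule lim_imp_Liminf [OF sequentially_bot, symmetric])
    qed
    also have "\<dots> \<le> liminf (\<lambda>n. \<integral>\<^sup>+x. ennreal (S n x ^ 4) \<partial>\<nu>)"
      using Sm by (intro nn_integral_liminf) auto
    also have "\<dots> \<le> liminf (\<lambda>n::nat. ennreal (K * (h \<bullet> \<Lambda> h)\<^sup>2))"
      by (intro Liminf_mono always_eventually allI S4)
    also have "\<dots> = ennreal (K * (h \<bullet> \<Lambda> h)\<^sup>2)" by (simp add: Liminf_const)
    finally show ?thesis .
  qed
  then show ?thesis using that K(1) by blast
qed

lemma exp_neg_le: "exp (- y) \<le> 1 - y + y\<^sup>2 / 2" if "y \<ge> 0" for y :: real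
proof -
  define f where "f y = 1 - y + y\<^sup>2 / 2 - exp (- y)" for y :: real
  have "f 0 \<le> f y"
  proof (rule DERIV_nonneg_imp_nondecreasing [OF that])
    fix x :: real
    have "(f has_real_derivative (x - 1 + exp (- x))) (at x)"
      unfolding f_def by (auto intro!: derivative_eq_intros)
    moreover have "x - 1 + exp (- x) \<ge> 0" using exp_ge_add_one_self [of "- x"] by linarith
    ultimately show "\<exists>y. (f has_real_derivative y) (at x) \<and> 0 \<le> y" by blast
  qed
  then show ?thesis by (simp add: f_def)
qed

text \<open>
  For a nonnegative variable, control of the second moment is enough for a bound on the lower
  exponential moments, because \<open>exp (- y) \<le> 1 - y + y\<^sup>2 / 2\<close>. The exponent \<open>1 / (2 * K * (h \<bullet> \<Lambda> h))\<close> makes the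
  first-order gain \<open>1 / (2 * K)\<close> exceed the second-order loss \<open>1 / (8 * K)\<close>.
\<close>
lemma exp_moment_marginal:
  fixes \<phi> :: "nat \<Rightarrow> 'h::{real_inner,banach,second_countable_topology}"
  assumes T: "training_distribution \<phi> \<nu> \<Lambda>" and K: "K > 0" and v: "h \<bullet> \<Lambda> h > 0"
    and K4: "(\<integral>\<^sup>+x. ennreal ((h \<bullet> x) ^ 4) \<partial>\<nu>) \<le> ennreal (K * (h \<bullet> \<Lambda> h)\<^sup>2)"
  shows "(\<integral>\<^sup>+x. ennreal (exp (- ((h \<bullet> x)\<^sup>2 / (2 * K * (h \<bullet> \<Lambda> h))))) \<partial>\<nu>) \<le> ennreal (exp (- (3 / (8 * K))))"
proof -
  from T interpret prob_space \<nu> by (simp add: training_distribution_def)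
  have sets [measurable_cong]: "sets \<nu> = sets borel"
    and cov: "\<And>h k. (\<integral>x. (h \<bullet> x) * (k \<bullet> x) \<partial>\<nu>) = h \<bullet> \<Lambda> k"
    using T by (auto simp: training_distribution_def)
  have hm [measurable]: "(\<lambda>x. h \<bullet> x) \<in> borel_measurable \<nu>" by measurable
  define w where "w = h \<bullet> \<Lambda> h"
  \<comment> \<open>The minimizer of \<open>- t * w / 2 + t\<^sup>2 * K * w\<^sup>2 / 2\<close>, the exponent per observation in the final bound.\<close>
  define t where "t = 1 / (2 * K * w)"
  have w: "w > 0" using v by (simp add: w_def)
  have t: "t > 0" using K w by (simp add: t_def)
  have I4: "integrable \<nu> (\<lambda>x. (h \<bullet> x) ^ 4)"
    using K4 by (intro integrableI_nonneg) (auto intro: le_less_trans)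
  have I2: "integrable \<nu> (\<lambda>x. (h \<bullet> x)\<^sup>2)"
    by (rule integrable_power_of_fourth [OF hm I4]) simp
  have E2: "expectation (\<lambda>x. (h \<bullet> x)\<^sup>2) = w"
    using cov [of h h] by (simp add: w_def power2_eq_square)
  have E4: "expectation (\<lambda>x. (h \<bullet> x) ^ 4) \<le> K * w\<^sup>2"
  proof -
    have "ennreal (expectation (\<lambda>x. (h \<bullet> x) ^ 4)) \<le> ennreal (K * w\<^sup>2)"
      using K4 by (subst nn_integral_eq_integral [symmetric, OF I4]) (auto simp: w_def)
    then show ?thesis using K by (simp add: ennreal_le_iff)
  qed
  have Ib: "integrable \<nu> (\<lambda>x. 1 - t * (h \<bullet> x)\<^sup>2 + t\<^sup>2 / 2 * (h \<bullet> x) ^ 4)"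
    using I2 I4 by auto
  have pw: "exp (- (t * y\<^sup>2)) \<le> 1 - t * y\<^sup>2 + t\<^sup>2 / 2 * y ^ 4" for y :: real
    using exp_neg_le [of "t * y\<^sup>2"] t by (simp add: power_mult_distrib flip: power_mult)
  have "(\<integral>\<^sup>+x. ennreal (exp (- ((h \<bullet> x)\<^sup>2 / (2 * K * (h \<bullet> \<Lambda> h))))) \<partial>\<nu>)
      = (\<integral>\<^sup>+x. ennreal (exp (- (t * (h \<bullet> x)\<^sup>2))) \<partial>\<nu>)"
    by (simp add: t_def w_def)
  also have "\<dots> \<le> (\<integral>\<^sup>+x. ennreal (1 - t * (h \<bullet> x)\<^sup>2 + t\<^sup>2 / 2 * (h \<bullet> x) ^ 4) \<partial>\<nu>)"
    by (intro nn_integral_mono ennreal_leI pw)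
  also have "\<dots> = ennreal (expectation (\<lambda>x. 1 - t * (h \<bullet> x)\<^sup>2 + t\<^sup>2 / 2 * (h \<bullet> x) ^ 4))"
  proof (rule nn_integral_eq_integral [OF Ib])
    have "0 \<le> 1 - t * (h \<bullet> x)\<^sup>2 + t\<^sup>2 / 2 * (h \<bullet> x) ^ 4" for x
      by (rule order_trans [OF exp_ge_zero pw])
    then show "AE x in \<nu>. 0 \<le> 1 - t * (h \<bullet> x)\<^sup>2 + t\<^sup>2 / 2 * (h \<bullet> x) ^ 4" by simp
  qed
  also have "expectation (\<lambda>x. 1 - t * (h \<bullet> x)\<^sup>2 + t\<^sup>2 / 2 * (h \<bullet> x) ^ 4)
      = 1 - t * w + t\<^sup>2 / 2 * expectation (\<lambda>x. (h \<bullet> x) ^ 4)"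
    using I2 I4 by (simp add: E2 prob_space)
  also have "\<dots> \<le> 1 - t * w + t\<^sup>2 / 2 * (K * w\<^sup>2)"
    using E4 by (intro add_left_mono mult_left_mono) auto
  also have "\<dots> = 1 + - (3 / (8 * K))"
    using K w unfolding t_def by (simp add: field_simps power2_eq_square)
  also have "\<dots> \<le> exp (- (3 / (8 * K)))"
    by (rule exp_ge_add_one_self)
  finally show ?thesis by (simp add: ennreal_leI)
qed

text \<open>
  Either the empirical variance is at least half of the true one, and then the shrinkage factor is
  at most \<open>2 / (1 + a * (h \<bullet> \<Lambda> h))\<close>, or it is smaller, an event of exponentially small probability
  on which the factor is bounded by \<open>1\<close>. Both cases are covered by one pointwise inequality in which
  an exponential plays the role of the indicator of the second case, as in Chernoff's bound.
  The exponentially small term does not depend on \<open>h\<close>, so it stays negligible after summing over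
  the coordinates.
\<close>
lemma expected_shrinkage_le:
  fixes \<phi> :: "nat \<Rightarrow> 'h::{real_inner,banach,second_countable_topology}"
  assumes T: "training_distribution \<phi> \<nu> \<Lambda>" and K: "K > 0" and v: "h \<bullet> \<Lambda> h > 0"
    and K4: "(\<integral>\<^sup>+x. ennreal ((h \<bullet> x) ^ 4) \<partial>\<nu>) \<le> ennreal (K * (h \<bullet> \<Lambda> h)\<^sup>2)"
    and N: "N \<ge> 1" and a: "a \<ge> 0"
  shows "(\<integral>\<^sup>+X. ennreal (1 / (1 + a * (1 / real N * (\<Sum>n<N. (h \<bullet> X n)\<^sup>2)))) \<partial>(\<Pi>\<^sub>M n\<in>{..<N}. \<nu>))
    \<le> ennreal (2 / (1 + a * (h \<bullet> \<Lambda> h)) + exp (- (real N / (8 * K))))"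
proof -
  from T interpret prob_space \<nu> by (simp add: training_distribution_def)
  interpret P: product_prob_space "\<lambda>_::nat. \<nu>" "{..<N}" by unfold_locales
  have sets [measurable_cong]: "sets \<nu> = sets borel"
    using T by (auto simp: training_distribution_def)
  let ?P = "\<Pi>\<^sub>M n\<in>{..<N}. \<nu>"
  define w where "w = h \<bullet> \<Lambda> h"
  define t where "t = 1 / (2 * K * w)"
  have w: "w > 0" using v by (simp add: w_def)
  have t: "t > 0" using K w by (simp add: t_def)
  define E where "E X = (\<Prod>n<N. exp (- ((h \<bullet> X n)\<^sup>2 / (2 * K * w))))" for X :: "nat \<Rightarrow> 'h"
  have pw: "1 / (1 + a * (1 / real N * (\<Sum>n<N. (h \<bullet> X n)\<^sup>2)))
      \<le> 2 / (1 + a * w) + exp (real N / (4 * K)) * E X" for X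
  proof -
    define G where "G = 1 / real N * (\<Sum>n<N. (h \<bullet> X n)\<^sup>2)"
    have G: "G \<ge> 0" by (auto simp: G_def sum_nonneg)
    have "E X = (\<Prod>n<N. exp (- t * (h \<bullet> X n)\<^sup>2))"
      unfolding E_def t_def by simp
    also have "\<dots> = exp (- t * (\<Sum>n<N. (h \<bullet> X n)\<^sup>2))"
      unfolding sum_distrib_left by (rule exp_sum [symmetric]) simp
    finally have "exp (real N / (4 * K)) * E X = exp (real N / (4 * K) - t * (\<Sum>n<N. (h \<bullet> X n)\<^sup>2))"
      by (simp flip: exp_add)
    also have "t * (\<Sum>n<N. (h \<bullet> X n)\<^sup>2) = t * real N * G"
      using N by (simp add: G_def)
    also have "real N / (4 * K) - t * real N * G = t * real N * (w / 2 - G)"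
      using K w by (simp add: t_def field_simps)
    finally have EX: "exp (real N / (4 * K)) * E X = exp (t * real N * (w / 2 - G))" .
    have "1 / (1 + a * G) \<le> 2 / (1 + a * w) + exp (t * real N * (w / 2 - G))"
    proof (cases "G \<ge> w / 2")
      case True
      then have "a * (w / 2) \<le> a * G" using a by (intro mult_left_mono) auto
      then have "1 + a * w \<le> 2 * (1 + a * G)" by simp
      moreover have "0 < 1 + a * w" "0 < 1 + a * G" using a w G by (auto intro!: add_pos_nonneg)
      ultimately have "1 / (1 + a * G) \<le> 2 / (1 + a * w)" by (simp add: field_simps)
      then show ?thesis by (simp add: add_increasing2)
    next
      case False
      then have "1 \<le> exp (t * real N * (w / 2 - G))" using t by simp
      moreover have "1 / (1 + a * G) \<le> 1"
        using mult_nonneg_nonneg [OF a G] by (simp add: divide_le_eq)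
      moreover have "0 \<le> 2 / (1 + a * w)" using a w by simp
      ultimately show ?thesis by linarith
    qed
    then show ?thesis unfolding EX unfolding G_def .
  qed
  have nn: "0 \<le> 2 / (1 + a * w)" using a w by simp
  have EX0: "0 \<le> E X" for X unfolding E_def by (simp add: prod_nonneg)
  have em: "(\<lambda>x. ennreal (exp (- ((h \<bullet> x)\<^sup>2 / (2 * K * w))))) \<in> borel_measurable \<nu>"
    by measurable
  have [measurable]: "(\<lambda>X. X n) \<in> measurable ?P borel" if "n < N" for n
    using measurable_component_singleton [of n "{..<N}" "\<lambda>_. \<nu>"] that
    by (simp cong: measurable_cong_sets add: sets)
  have Em [measurable]: "E \<in> borel_measurable ?P"
    unfolding E_def by measurable
  have IE: "(\<integral>\<^sup>+X. ennreal (E X) \<partial>?P) \<le> ennreal (exp (- (3 * real N / (8 * K))))"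
  proof -
    have "(\<integral>\<^sup>+X. ennreal (E X) \<partial>?P)
      = (\<integral>\<^sup>+X. (\<Prod>n<N. ennreal (exp (- ((h \<bullet> X n)\<^sup>2 / (2 * K * w))))) \<partial>?P)"
      unfolding E_def by (simp add: prod_ennreal)
    also have "\<dots> = (\<Prod>n<N. \<integral>\<^sup>+x. ennreal (exp (- ((h \<bullet> x)\<^sup>2 / (2 * K * w)))) \<partial>\<nu>)"
      by (rule P.product_nn_integral_prod) (simp_all only: finite_lessThan em)
    also have "\<dots> \<le> (\<Prod>n<N. ennreal (exp (- (3 / (8 * K)))))"
      by (induction N) (auto intro!: mult_mono exp_moment_marginal [OF T K v K4, folded w_def])
    also have "\<dots> = ennreal (exp (- (3 / (8 * K))) ^ N)" by (simp add: ennreal_power)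
    also have "exp (- (3 / (8 * K))) ^ N = exp (- (3 * real N / (8 * K)))"
      by (simp flip: exp_of_nat_mult add: mult.commute)
    finally show ?thesis .
  qed
  have "(\<integral>\<^sup>+X. ennreal (1 / (1 + a * (1 / real N * (\<Sum>n<N. (h \<bullet> X n)\<^sup>2)))) \<partial>?P)
      \<le> (\<integral>\<^sup>+X. ennreal (2 / (1 + a * w)) + ennreal (exp (real N / (4 * K))) * ennreal (E X) \<partial>?P)"
    using pw nn EX0 by (intro nn_integral_mono) (simp flip: ennreal_mult ennreal_plus add: ennreal_leI)
  also have "\<dots> = ennreal (2 / (1 + a * w)) + ennreal (exp (real N / (4 * K))) * (\<integral>\<^sup>+X. ennreal (E X) \<partial>?P)"
    by (subst nn_integral_add) (auto simp: nn_integral_cmult P.emeasure_space_1)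
  also have "\<dots> \<le> ennreal (2 / (1 + a * w)) +
      ennreal (exp (real N / (4 * K))) * ennreal (exp (- (3 * real N / (8 * K))))"
    by (intro add_left_mono mult_left_mono IE) auto
  also have "\<dots> = ennreal (2 / (1 + a * w) + exp (- (real N / (8 * K))))"
  proof -
    have "exp (real N / (4 * K)) * exp (- (3 * real N / (8 * K))) = exp (- (real N / (8 * K)))"
      using K by (simp flip: exp_add add: field_simps)
    then show ?thesis using nn by (simp flip: ennreal_mult)
  qed
  finally show ?thesis by (simp add: w_def)
qed

section \<open>Posterior risk of one coordinate\<close>

lemma gaussian_moments:
  assumes "sd > 0"
  shows "prob_space (gaussian m sd)"
    and "integrable (gaussian m sd) (\<lambda>x. (x - c)\<^sup>2)"
    and "(\<integral>x. (x - c)\<^sup>2 \<partial>gaussian m sd) = (m - c)\<^sup>2 + sd\<^sup>2"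
    and "(\<integral>x. x \<partial>gaussian m sd) = m"
proof -
  show "prob_space (gaussian m sd)"
    unfolding gaussian_def by (rule prob_space_normal_density [OF assms])
  let ?f = "normal_density m sd"
  have sq: "?f x * (x - c)\<^sup>2 = ?f x * (x - m) ^ (2 * 1) + 2 * (m - c) * (?f x * (x - m) ^ (2 * 0 + 1))
      + (m - c)\<^sup>2 * ?f x" for x
    by (simp add: power2_eq_square algebra_simps)
  note I = integrable_normal_moment [OF assms, of m "2 * 1"] integrable_normal_moment [OF assms, of m "2 * 0 + 1"]
    integrable_normal_density [OF assms, of m]
  show "integrable (gaussian m sd) (\<lambda>x. (x - c)\<^sup>2)"
    unfolding gaussian_def using I by (subst integrable_real_density) (simp_all only: sq, auto)
  have "(\<integral>x. (x - c)\<^sup>2 \<partial>gaussian m sd) = (\<integral>x. ?f x * (x - c)\<^sup>2 \<partial>lborel)"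
    unfolding gaussian_def by (subst integral_real_density) auto
  also have "\<dots> = (\<integral>x. ?f x * (x - m) ^ (2 * 1) \<partial>lborel)
      + 2 * (m - c) * (\<integral>x. ?f x * (x - m) ^ (2 * 0 + 1) \<partial>lborel) + (m - c)\<^sup>2 * (\<integral>x. ?f x \<partial>lborel)"
    unfolding sq using I by simp
  also have "\<dots> = (m - c)\<^sup>2 + sd\<^sup>2"
    unfolding integral_normal_moment_even [OF assms] integral_normal_moment_odd [OF assms]
      integral_normal_density [OF assms] by (simp add: fact_2)
  finally show "(\<integral>x. (x - c)\<^sup>2 \<partial>gaussian m sd) = (m - c)\<^sup>2 + sd\<^sup>2" .
  have "(\<integral>x. x \<partial>gaussian m sd) = (\<integral>x. ?f x * x \<partial>lborel)"
    unfolding gaussian_def by (subst integral_real_density) auto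
  then show "(\<integral>x. x \<partial>gaussian m sd) = m"
    using integral_normal_moment_nz_1 [OF assms, of m] by simp
qed

lemma sets_gaussian [simp, measurable_cong]: "sets (gaussian m sd) = sets borel"
  and space_gaussian [simp]: "space (gaussian m sd) = UNIV"
  by (auto simp: gaussian_def)

lemma integral_PiM_coordinate:
  fixes f :: "'a \<Rightarrow> real"
  assumes "\<And>i. i \<in> I \<Longrightarrow> prob_space (M i)" "i \<in> I" "f \<in> borel_measurable (M i)"
  shows "integrable (Pi\<^sub>M I M) (\<lambda>x. f (x i)) \<longleftrightarrow> integrable (M i) f"
    and "(\<integral>x. f (x i) \<partial>Pi\<^sub>M I M) = (\<integral>x. f x \<partial>M i)"
  using assms integrable_distr_eq [of "\<lambda>x. x i" "Pi\<^sub>M I M" "M i" f]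
    integral_distr [of "\<lambda>x. x i" "Pi\<^sub>M I M" "M i" f]
  by (simp_all add: distr_PiM_component)

lemma second_moment_noise:
  fixes N j :: nat and w :: "nat \<Rightarrow> real"
  assumes "N \<ge> 1"
  shows "(\<integral>\<^sup>+\<xi>. ennreal ((c + (\<Sum>n<N. w n * \<xi> (j, n)))\<^sup>2) \<partial>(\<Pi>\<^sub>M jn\<in>UNIV \<times> {..<N}. gaussian 0 1))
    = ennreal (c\<^sup>2 + (\<Sum>n<N. (w n)\<^sup>2))"
proof -
  let ?I = "(UNIV :: nat set) \<times> {..<N}"
  let ?Q = "\<Pi>\<^sub>M jn\<in>?I. gaussian 0 1"
  have g: "prob_space (gaussian 0 1)" by (rule gaussian_moments) simp
  interpret Q: prob_space ?Q by (rule prob_space_PiM) (rule g)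
  have comp: "(\<lambda>\<xi>. \<xi> i) \<in> measurable ?Q borel" if "i \<in> ?I" for i
    using measurable_component_singleton [OF that, of "\<lambda>_. gaussian 0 1"]
    by (simp add: measurable_cong_sets [OF refl sets_gaussian])
  have "(0, 0) \<in> ?I" using assms by simp
  then have ne: "?I \<noteq> {}" by blast
  have ind: "Q.indep_vars (\<lambda>_. borel) (\<lambda>i \<xi>. \<xi> i) ?I"
  proof (subst Q.indep_vars_iff_distr_eq_PiM' [OF ne comp])
    have "distr ?Q (\<Pi>\<^sub>M i\<in>?I. borel) (\<lambda>\<xi>. \<lambda>i\<in>?I. \<xi> i) = distr ?Q ?Q (\<lambda>\<xi>. \<xi>)"
      by (intro distr_cong sets_PiM_cong) (auto simp: space_PiM PiE_def extensional_restrict)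
    also have "\<dots> = ?Q" by (rule distr_id)
    also have "\<dots> = (\<Pi>\<^sub>M i\<in>?I. distr ?Q borel (\<lambda>\<xi>. \<xi> i))"
    proof (rule PiM_cong)
      fix i assume i: "i \<in> ?I"
      have "distr ?Q borel (\<lambda>\<xi>. \<xi> i) = distr ?Q (gaussian 0 1) (\<lambda>\<xi>. \<xi> i)"
        by (rule distr_cong) auto
      then show "gaussian 0 1 = distr ?Q borel (\<lambda>\<xi>. \<xi> i)"
        using distr_PiM_component [of ?I "\<lambda>_. gaussian 0 1", OF g i] by simp
    qed simp
    finally show "distr ?Q (\<Pi>\<^sub>M i\<in>?I. borel) (\<lambda>\<xi>. \<lambda>i\<in>?I. \<xi> i) = (\<Pi>\<^sub>M i\<in>?I. distr ?Q borel (\<lambda>\<xi>. \<xi> i))" .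
  qed
  \<comment> \<open>Only the noise variables of row \<open>j\<close> enter, so the index set is cut down to this row.\<close>
  define Z where "Z i \<xi> = w (snd i) * \<xi> i" for i :: "nat \<times> nat" and \<xi> :: "nat \<times> nat \<Rightarrow> real"
  let ?J = "{j} \<times> {..<N}"
  have sum_J: "(\<Sum>i\<in>?J. f i) = (\<Sum>n<N. f (j, n))" for f :: "nat \<times> nat \<Rightarrow> real"
    by (rule sum.reindex_bij_witness [where i = "\<lambda>n. (j, n)" and j = snd]) auto
  have indZ: "Q.indep_vars (\<lambda>_. borel) Z ?J"
    unfolding Z_def
    by (rule Q.indep_vars_compose2 [OF Q.indep_vars_subset [OF ind]]) auto
  have m2: "integrable ?Q (\<lambda>\<xi>. (\<xi> i)\<^sup>2)" "Q.expectation (\<lambda>\<xi>. (\<xi> i)\<^sup>2) = 1" "Q.expectation (\<lambda>\<xi>. \<xi> i) = 0"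
    if "i \<in> ?I" for i
    using integral_PiM_coordinate [of ?I "\<lambda>_. gaussian 0 1" i "\<lambda>x. x\<^sup>2", OF g that]
      integral_PiM_coordinate [of ?I "\<lambda>_. gaussian 0 1" i "\<lambda>x. x", OF g that]
      gaussian_moments(2,3) [of 1 0 0] gaussian_moments(4) [of 1 0] by simp_all
  have Z2: "integrable ?Q (\<lambda>\<xi>. (Z i \<xi>)\<^sup>2)" "Q.expectation (\<lambda>\<xi>. (Z i \<xi>)\<^sup>2) = (w (snd i))\<^sup>2"
    "Q.expectation (Z i) = 0" if "i \<in> ?J" for i
    using m2 [of i] that unfolding Z_def by (auto simp: power_mult_distrib)
  define S where "S \<xi> = (\<Sum>i\<in>?J. Z i \<xi>)" for \<xi>
  have S: "integrable ?Q (\<lambda>\<xi>. (S \<xi>)\<^sup>2)" "Q.expectation (\<lambda>\<xi>. (S \<xi>)\<^sup>2) = (\<Sum>i\<in>?J. (w (snd i))\<^sup>2)"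
    "integrable ?Q S" "Q.expectation S = 0"
    using Q.second_moment_indep_sum [OF _ indZ Z2(1,3)] Z2(2) unfolding S_def by auto
  have S_eq: "S \<xi> = (\<Sum>n<N. w n * \<xi> (j, n))" for \<xi>
    unfolding S_def Z_def sum_J by simp
  have sq: "(c + S \<xi>)\<^sup>2 = c\<^sup>2 + 2 * c * S \<xi> + (S \<xi>)\<^sup>2" for \<xi>
    by (simp add: power2_sum)
  have I: "integrable ?Q (\<lambda>\<xi>. (c + S \<xi>)\<^sup>2)"
    unfolding sq using S by simp
  have "(\<integral>\<^sup>+\<xi>. ennreal ((c + S \<xi>)\<^sup>2) \<partial>?Q) = ennreal (Q.expectation (\<lambda>\<xi>. (c + S \<xi>)\<^sup>2))"
    by (rule nn_integral_eq_integral [OF I]) auto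
  also have "Q.expectation (\<lambda>\<xi>. (c + S \<xi>)\<^sup>2) = c\<^sup>2 + (\<Sum>i\<in>?J. (w (snd i))\<^sup>2)"
    unfolding sq using S by (simp add: Q.prob_space)
  also have "(\<Sum>i\<in>?J. (w (snd i))\<^sup>2) = (\<Sum>n<N. (w n)\<^sup>2)"
    unfolding sum_J by simp
  finally show ?thesis unfolding S_eq .
qed

text \<open>
  The posterior expectation of \<open>(l j - l' j)\<^sup>2\<close>: squared error of the posterior mean plus posterior
  variance.
\<close>
definition coordinate_risk ::
  "(nat \<Rightarrow> 'h::real_inner) \<Rightarrow> real \<Rightarrow> (nat \<Rightarrow> real) \<Rightarrow> (nat \<Rightarrow> real) \<Rightarrow> nat
     \<Rightarrow> (nat \<Rightarrow> 'h) \<times> (nat \<times> nat \<Rightarrow> real) \<Rightarrow> nat \<Rightarrow> real" where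
  "coordinate_risk \<phi> \<gamma> \<sigma> l N D j =
     (l j - posterior_mean \<phi> \<gamma> \<sigma> N D j)\<^sup>2 + posterior_var \<phi> \<gamma> \<sigma> N D j"

lemma coordinate_risk_eq:
  "coordinate_risk \<phi> \<gamma> \<sigma> l N D j =
     (l j - (real N / \<gamma>\<^sup>2 * (\<sigma> j)\<^sup>2 * ((1 / real N) * (\<Sum>n<N. snd D (j, n) * (\<phi> j \<bullet> fst D n)))) /
       (1 + real N / \<gamma>\<^sup>2 * (\<sigma> j)\<^sup>2 * ((1 / real N) * (\<Sum>n<N. (\<phi> j \<bullet> fst D n)\<^sup>2))))\<^sup>2 +
     (\<sigma> j)\<^sup>2 / (1 + real N / \<gamma>\<^sup>2 * (\<sigma> j)\<^sup>2 * ((1 / real N) * (\<Sum>n<N. (\<phi> j \<bullet> fst D n)\<^sup>2)))"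
  by (cases D) (simp add: coordinate_risk_def)

lemma sets_posterior: "sets (posterior \<phi> \<gamma> \<sigma> N D) = sets (\<Pi>\<^sub>M j\<in>UNIV. borel)"
  unfolding posterior_def by (rule sets_PiM_cong) auto

lemma posterior_var_pos:
  assumes "\<sigma> j > 0"
  shows "posterior_var \<phi> \<gamma> \<sigma> N D j > 0"
proof (cases D)
  case (Pair X Y)
  have "0 \<le> real N / \<gamma>\<^sup>2 * (\<sigma> j)\<^sup>2 * ((1 / real N) * (\<Sum>n<N. (\<phi> j \<bullet> X n)\<^sup>2))"
    by (intro mult_nonneg_nonneg sum_nonneg) auto
  then show ?thesis using assms Pair by (simp add: add_pos_nonneg)
qed

text \<open>
  Given the inputs, put \<open>u = N / \<gamma>\<^sup>2 * (\<sigma> j)\<^sup>2\<close> times the empirical variance. The error of the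
  posterior mean is \<open>l j / (1 + u)\<close> plus a centered Gaussian of variance \<open>(\<sigma> j)\<^sup>2 * u / (1 + u)\<^sup>2\<close>,
  and the posterior variance is \<open>(\<sigma> j)\<^sup>2 / (1 + u)\<close>. Bounding \<open>1 / (1 + u)\<^sup>2\<close> by \<open>1 / (1 + u)\<close>
  loses nothing in the final rate.
\<close>
lemma conditional_risk_le:
  fixes \<phi> :: "nat \<Rightarrow> 'h::real_inner"
  assumes N: "N \<ge> 1" and \<gamma>: "\<gamma> > 0"
  shows "(\<integral>\<^sup>+\<xi>. ennreal (coordinate_risk \<phi> \<gamma> \<sigma> l N
        (X, \<lambda>(j, n)\<in>UNIV \<times> {..<N}. (\<phi> j \<bullet> X n) * l j + \<gamma> * \<xi> (j, n)) j)
      \<partial>(\<Pi>\<^sub>M jn\<in>UNIV \<times> {..<N}. gaussian 0 1))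
    \<le> ennreal (((l j)\<^sup>2 + 2 * (\<sigma> j)\<^sup>2) *
        (1 / (1 + real N / \<gamma>\<^sup>2 * (\<sigma> j)\<^sup>2 * (1 / real N * (\<Sum>n<N. (\<phi> j \<bullet> X n)\<^sup>2)))))"
proof -
  let ?Q = "\<Pi>\<^sub>M jn\<in>(UNIV::nat set) \<times> {..<N}. gaussian 0 1"
  have g: "prob_space (gaussian 0 1)" by (rule gaussian_moments) simp
  interpret Q: prob_space ?Q by (rule prob_space_PiM) (rule g)
  have comp: "(\<lambda>\<xi>. \<xi> (j, n)) \<in> measurable ?Q borel" if "n < N" for n
    using measurable_component_singleton [of "(j, n)" "UNIV \<times> {..<N}" "\<lambda>_. gaussian 0 1"] that
    by (simp add: measurable_cong_sets [OF refl sets_gaussian])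
  define g where "g n = \<phi> j \<bullet> X n" for n
  define u where "u = (\<sigma> j)\<^sup>2 * (\<Sum>n<N. (g n)\<^sup>2) / \<gamma>\<^sup>2"
  have u: "u \<ge> 0" by (auto simp: u_def sum_nonneg)
  then have u1: "1 + u > 0" by simp
  have uG: "real N / \<gamma>\<^sup>2 * (\<sigma> j)\<^sup>2 * (1 / real N * (\<Sum>n<N. (\<phi> j \<bullet> X n)\<^sup>2)) = u"
    using N by (simp add: u_def g_def)
  define c where "c = l j / (1 + u)"
  define w where "w n = - ((\<sigma> j)\<^sup>2 / (\<gamma> * (1 + u))) * g n" for n
  have risk: "coordinate_risk \<phi> \<gamma> \<sigma> l N
        (X, \<lambda>(j, n)\<in>UNIV \<times> {..<N}. (\<phi> j \<bullet> X n) * l j + \<gamma> * \<xi> (j, n)) j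
      = (c + (\<Sum>n<N. w n * \<xi> (j, n)))\<^sup>2 + (\<sigma> j)\<^sup>2 / (1 + u)" for \<xi>
  proof -
    define R where "R = (\<Sum>n<N. g n * \<xi> (j, n))"
    have "(\<Sum>n<N. (g n * l j + \<gamma> * \<xi> (j, n)) * g n) = l j * (\<Sum>n<N. (g n)\<^sup>2) + \<gamma> * R"
      unfolding R_def by (simp add: sum_distrib_left sum.distrib power2_eq_square algebra_simps)
    then have num: "real N / \<gamma>\<^sup>2 * (\<sigma> j)\<^sup>2 * (1 / real N * (\<Sum>n<N. (g n * l j + \<gamma> * \<xi> (j, n)) * g n))
        = u * l j + (\<sigma> j)\<^sup>2 / \<gamma> * R"
      using N \<gamma> by (simp add: u_def power2_eq_square field_simps)
    have wR: "(\<Sum>n<N. w n * \<xi> (j, n)) = - ((\<sigma> j)\<^sup>2 / (\<gamma> * (1 + u)) * R)"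
      unfolding R_def w_def by (simp add: sum_distrib_left sum_negf mult.assoc)
    have "l j - (u * l j + (\<sigma> j)\<^sup>2 / \<gamma> * R) / (1 + u) = c + (\<Sum>n<N. w n * \<xi> (j, n))"
    proof -
      have "u * l j / (1 + u) = l j - c" using u1 by (simp add: c_def field_simps)
      then show ?thesis unfolding wR by (simp add: add_divide_distrib)
    qed
    moreover have "(\<Sum>n<N. (\<lambda>(j, n)\<in>UNIV \<times> {..<N}. (\<phi> j \<bullet> X n) * l j + \<gamma> * \<xi> (j, n)) (j, n) * (\<phi> j \<bullet> X n))
        = (\<Sum>n<N. (g n * l j + \<gamma> * \<xi> (j, n)) * g n)"
      unfolding g_def by (intro sum.cong) auto
    ultimately show ?thesis
      unfolding coordinate_risk_eq fst_conv snd_conv uG by (simp only: num)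
  qed
  have w2: "(\<Sum>n<N. (w n)\<^sup>2) = (\<sigma> j)\<^sup>2 * u / (1 + u)\<^sup>2"
    using \<gamma> u1 unfolding w_def power_mult_distrib sum_distrib_left [symmetric]
    by (simp add: u_def power2_eq_square mult_ac)
  have "(\<integral>\<^sup>+\<xi>. ennreal ((c + (\<Sum>n<N. w n * \<xi> (j, n)))\<^sup>2 + (\<sigma> j)\<^sup>2 / (1 + u)) \<partial>?Q)
      = (\<integral>\<^sup>+\<xi>. ennreal ((c + (\<Sum>n<N. w n * \<xi> (j, n)))\<^sup>2) \<partial>?Q) + ennreal ((\<sigma> j)\<^sup>2 / (1 + u))"
    using u comp
    by (simp add: ennreal_plus) (subst nn_integral_add, auto simp: Q.emeasure_space_1)
  also have "\<dots> = ennreal (c\<^sup>2 + (\<sigma> j)\<^sup>2 * u / (1 + u)\<^sup>2 + (\<sigma> j)\<^sup>2 / (1 + u))"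
    unfolding second_moment_noise [OF N] w2 using u by (subst ennreal_plus [symmetric]) auto
  also have "\<dots> \<le> ennreal (((l j)\<^sup>2 + 2 * (\<sigma> j)\<^sup>2) * (1 / (1 + u)))"
  proof (rule ennreal_leI)
    have sq: "1 + u \<le> (1 + u)\<^sup>2" using u by (simp add: power2_eq_square algebra_simps)
    have "c\<^sup>2 \<le> (l j)\<^sup>2 / (1 + u)"
      unfolding c_def power_divide using u1 by (intro divide_left_mono sq) auto
    moreover have "(\<sigma> j)\<^sup>2 * u / (1 + u)\<^sup>2 \<le> (\<sigma> j)\<^sup>2 / (1 + u)"
    proof -
      have "(\<sigma> j)\<^sup>2 * u / (1 + u)\<^sup>2 \<le> (\<sigma> j)\<^sup>2 * (1 + u) / (1 + u)\<^sup>2"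
        using u by (intro divide_right_mono mult_left_mono) auto
      also have "\<dots> = (\<sigma> j)\<^sup>2 / (1 + u)" using u1 by (simp add: power2_eq_square)
      finally show ?thesis .
    qed
    ultimately show "c\<^sup>2 + (\<sigma> j)\<^sup>2 * u / (1 + u)\<^sup>2 + (\<sigma> j)\<^sup>2 / (1 + u)
        \<le> ((l j)\<^sup>2 + 2 * (\<sigma> j)\<^sup>2) * (1 / (1 + u))"
      by (simp add: add_divide_distrib)
  qed
  finally show ?thesis unfolding risk uG .
qed

lemma posterior_second_moment:
  assumes "\<And>j. \<sigma> j > 0"
  shows "(\<integral>\<^sup>+l'. ennreal ((l j - l' j)\<^sup>2) \<partial>posterior \<phi> \<gamma> \<sigma> N D) = ennreal (coordinate_risk \<phi> \<gamma> \<sigma> l N D j)"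
proof -
  let ?G = "\<lambda>j. gaussian (posterior_mean \<phi> \<gamma> \<sigma> N D j) (sqrt (posterior_var \<phi> \<gamma> \<sigma> N D j))"
  have sd: "sqrt (posterior_var \<phi> \<gamma> \<sigma> N D j) > 0" for j
    using posterior_var_pos [of \<sigma> j] assms by simp
  have P: "prob_space (?G j)" for j by (rule gaussian_moments [OF sd])
  have "(\<integral>\<^sup>+l'. ennreal ((l j - l' j)\<^sup>2) \<partial>posterior \<phi> \<gamma> \<sigma> N D)
      = (\<integral>\<^sup>+x. ennreal ((l j - x)\<^sup>2) \<partial>distr (Pi\<^sub>M UNIV ?G) (?G j) (\<lambda>l'. l' j))"
    unfolding posterior_def by (subst nn_integral_distr) auto
  also have "distr (Pi\<^sub>M UNIV ?G) (?G j) (\<lambda>l'. l' j) = ?G j"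
    by (rule distr_PiM_component) (auto simp: P)
  also have "(\<integral>\<^sup>+x. ennreal ((l j - x)\<^sup>2) \<partial>?G j) = ennreal (\<integral>x. (x - l j)\<^sup>2 \<partial>?G j)"
    by (subst nn_integral_eq_integral [symmetric, OF gaussian_moments(2) [OF sd]])
       (auto simp: power2_commute)
  also have "\<dots> = ennreal (coordinate_risk \<phi> \<gamma> \<sigma> l N D j)"
    unfolding gaussian_moments(3) [OF sd] coordinate_risk_def
    using posterior_var_pos [of \<sigma> j \<phi> \<gamma> N D] assms by (simp add: power2_commute less_imp_le)
  finally show ?thesis .
qed

section \<open>The test norm as a weighted sum over coordinates\<close>

lemma norm_sq_orthonormal_sum:
  fixes \<phi> :: "nat \<Rightarrow> 'h::real_inner"
  assumes "orthonormal_basis \<phi>" "finite A"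
  shows "(norm (\<Sum>i\<in>A. c i *\<^sub>R \<phi> i))\<^sup>2 = (\<Sum>i\<in>A. (c i)\<^sup>2)"
proof -
  have on: "\<phi> i \<bullet> \<phi> j = (if i = j then 1 else 0)" for i j
    using assms by (simp add: orthonormal_basis_def)
  show ?thesis
    unfolding power2_norm_eq_inner using assms(2)
    by (simp add: inner_sum_left inner_sum_right on if_distrib power2_eq_square cong: if_cong)
qed

lemma norm_sq_orthonormal_series:
  fixes \<phi> :: "nat \<Rightarrow> 'h::{real_inner,banach}"
  assumes on: "orthonormal_basis \<phi>" and c: "summable (\<lambda>j. (c j)\<^sup>2)"
  shows "(norm (\<Sum>j. c j *\<^sub>R \<phi> j))\<^sup>2 = (\<Sum>j. (c j)\<^sup>2)"
proof -
  have "summable (\<lambda>j. c j *\<^sub>R \<phi> j)"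
    unfolding summable_Cauchy
  proof safe
    fix e :: real assume e: "e > 0"
    then obtain N where N: "\<And>m n. m \<ge> N \<Longrightarrow> norm (\<Sum>j = m..<n. (c j)\<^sup>2) < e\<^sup>2"
      using c unfolding summable_Cauchy by (meson zero_less_power)
    have "norm (\<Sum>j = m..<n. c j *\<^sub>R \<phi> j) < e" if "m \<ge> N" for m n
    proof (rule power_less_imp_less_base)
      show "(norm (\<Sum>j = m..<n. c j *\<^sub>R \<phi> j))\<^sup>2 < e\<^sup>2"
        using N [OF that, of n] by (simp add: norm_sq_orthonormal_sum [OF on])
    qed (use e in auto)
    then show "\<exists>N. \<forall>m\<ge>N. \<forall>n. norm (\<Sum>j = m..<n. c j *\<^sub>R \<phi> j) < e" by blast
  qed
  then have "(\<lambda>n. (norm (\<Sum>j<n. c j *\<^sub>R \<phi> j))\<^sup>2) \<longlonglongrightarrow> (norm (\<Sum>j. c j *\<^sub>R \<phi> j))\<^sup>2"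
    by (intro tendsto_intros summable_LIMSEQ)
  then have "(\<lambda>n. \<Sum>j<n. (c j)\<^sup>2) \<longlonglongrightarrow> (norm (\<Sum>j. c j *\<^sub>R \<phi> j))\<^sup>2"
    by (simp add: norm_sq_orthonormal_sum [OF on])
  then show ?thesis using LIMSEQ_unique summable_LIMSEQ [OF c] by blast
qed

text \<open>
  If the right-hand side is finite, then almost every test input lies in the domain of the diagonal
  operator, and Parseval's identity followed by integration term by term gives the bound.
\<close>
lemma test_norm_sq_le:
  fixes \<phi> :: "nat \<Rightarrow> 'h::{real_inner,banach,second_countable_topology}"
  assumes on: "orthonormal_basis \<phi>" and T: "test_distribution \<phi> \<nu>' \<Lambda>'"
  shows "test_norm_sq \<phi> \<nu>' t \<le> (\<Sum>j. ennreal (\<phi> j \<bullet> \<Lambda>' (\<phi> j)) * ennreal ((t j)\<^sup>2))"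
    (is "_ \<le> ?R")
proof (cases "?R = \<infinity>")
  case False
  have sets [measurable_cong]: "sets \<nu>' = sets borel"
    and sq: "\<And>j. integrable \<nu>' (\<lambda>x. (x j)\<^sup>2)"
    and cov: "\<And>j. (\<integral>x. (x j)\<^sup>2 \<partial>\<nu>') = \<phi> j \<bullet> \<Lambda>' (\<phi> j)"
    using T by (auto simp: test_distribution_def power2_eq_square)
  have coord: "(\<lambda>x. x j) \<in> borel_measurable \<nu>'" for j :: nat
    unfolding measurable_cong_sets [OF sets refl]
    by (rule borel_measurable_continuous_onI) (rule continuous_on_product_coordinates)
  have one: "(\<integral>\<^sup>+x. ennreal ((t j * x j)\<^sup>2) \<partial>\<nu>') = ennreal (\<phi> j \<bullet> \<Lambda>' (\<phi> j)) * ennreal ((t j)\<^sup>2)" for j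
  proof -
    have "(\<integral>\<^sup>+x. ennreal ((t j * x j)\<^sup>2) \<partial>\<nu>') = ennreal (\<integral>x. (t j * x j)\<^sup>2 \<partial>\<nu>')"
      using sq [of j] by (intro nn_integral_eq_integral) (auto simp: power_mult_distrib)
    also have "(\<integral>x. (t j * x j)\<^sup>2 \<partial>\<nu>') = (\<phi> j \<bullet> \<Lambda>' (\<phi> j)) * (t j)\<^sup>2"
      by (simp add: power_mult_distrib cov)
    finally show ?thesis by (simp add: ennreal_mult'')
  qed
  have meas: "(\<lambda>x. ennreal ((t j * x j)\<^sup>2)) \<in> borel_measurable \<nu>'" for j
    by (intro measurable_compose [OF _ measurable_ennreal] borel_measurable_power
        borel_measurable_times borel_measurable_const coord)
  have R: "(\<integral>\<^sup>+x. (\<Sum>j. ennreal ((t j * x j)\<^sup>2)) \<partial>\<nu>') = ?R"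
    unfolding nn_integral_suminf [OF meas] one ..
  have "AE x in \<nu>'. (\<Sum>j. ennreal ((t j * x j)\<^sup>2)) \<noteq> \<infinity>"
    by (rule nn_integral_PInf_AE [OF borel_measurable_suminf_order [OF meas]]) (simp only: R False not_False_eq_True)
  then have "AE x in \<nu>'. (if x \<in> diag_dom t then ennreal ((norm (diag_op \<phi> t x))\<^sup>2) else \<infinity>)
      \<le> (\<Sum>j. ennreal ((t j * x j)\<^sup>2))"
  proof eventually_elim
    case (elim x)
    then have s: "summable (\<lambda>j. (t j * x j)\<^sup>2)"
      by (intro summable_suminf_not_top) (auto simp: top_ennreal_def infinity_ennreal_def)
    then show ?case
      by (simp add: diag_dom_def diag_op_def norm_sq_orthonormal_series [OF on] suminf_ennreal2)
  qed
  then show ?thesis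
    unfolding test_norm_sq_def by (subst R [symmetric]) (rule nn_integral_mono_AE)
qed simp

text \<open>
  Markov's inequality for the posterior. The event is first enlarged to one defined by the weighted
  sum of squared coordinates, whose measurability is evident.
\<close>
lemma posterior_tail_le:
  fixes \<phi> :: "nat \<Rightarrow> 'h::{real_inner,banach,second_countable_topology}"
  assumes on: "orthonormal_basis \<phi>" and T: "test_distribution \<phi> \<nu>' \<Lambda>'" and \<sigma>: "\<And>j. \<sigma> j > 0"
    and \<delta>: "\<delta> > 0"
  shows "emeasure (posterior \<phi> \<gamma> \<sigma> N D) {l'. test_norm \<phi> \<nu>' (\<lambda>j. l j - l' j) \<ge> ennreal \<delta>}
    \<le> ennreal (1 / \<delta>\<^sup>2) * (\<Sum>j. ennreal (\<phi> j \<bullet> \<Lambda>' (\<phi> j)) * ennreal (coordinate_risk \<phi> \<gamma> \<sigma> l N D j))"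
proof -
  let ?P = "posterior \<phi> \<gamma> \<sigma> N D"
  define U where "U l' = (\<Sum>j. ennreal (\<phi> j \<bullet> \<Lambda>' (\<phi> j)) * ennreal ((l j - l' j)\<^sup>2))" for l' :: "nat \<Rightarrow> real"
  have coord: "(\<lambda>l'. l' j) \<in> measurable ?P borel" for j
    using measurable_component_singleton [of j UNIV "\<lambda>_. borel"]
    by (simp add: sets_posterior cong: measurable_cong_sets)
  have term_meas: "(\<lambda>l'. ennreal ((l j - l' j)\<^sup>2)) \<in> borel_measurable ?P" for j
    by (intro measurable_compose [OF _ measurable_ennreal] borel_measurable_power
        borel_measurable_diff borel_measurable_const coord)
  have U [measurable]: "U \<in> borel_measurable ?P"
    unfolding U_def by (intro borel_measurable_suminf_order borel_measurable_times_ennreal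
        borel_measurable_const term_meas)
  have sp: "space ?P = UNIV" by (simp add: posterior_def space_PiM)
  have sub: "{l'. test_norm \<phi> \<nu>' (\<lambda>j. l j - l' j) \<ge> ennreal \<delta>} \<subseteq> {l' \<in> space ?P. 1 \<le> ennreal (1 / \<delta>\<^sup>2) * U l'}"
  proof safe
    fix l' assume *: "ennreal \<delta> \<le> test_norm \<phi> \<nu>' (\<lambda>j. l j - l' j)"
    show "l' \<in> space ?P" by (simp add: sp)
    let ?s = "test_norm_sq \<phi> \<nu>' (\<lambda>j. l j - l' j)"
    have le: "?s \<le> U l'" unfolding U_def by (rule test_norm_sq_le [OF on T])
    have "ennreal (\<delta>\<^sup>2) \<le> ?s"
    proof (cases "?s = \<infinity>")
      case False
      then obtain z where z: "?s = ennreal z" "z \<ge> 0" by (cases ?s) auto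
      have "\<delta> \<le> sqrt z" using * z by (simp add: test_norm_def)
      then have "\<delta>\<^sup>2 \<le> z" using power_mono [of \<delta> "sqrt z" 2] \<delta> z by simp
      then show ?thesis using z by (simp add: ennreal_leI)
    qed simp
    then have "ennreal (1 / \<delta>\<^sup>2) * ennreal (\<delta>\<^sup>2) \<le> ennreal (1 / \<delta>\<^sup>2) * U l'"
      using le by (intro mult_left_mono) auto
    moreover have "ennreal (1 / \<delta>\<^sup>2) * ennreal (\<delta>\<^sup>2) = 1"
      using \<delta> by (simp flip: ennreal_mult')
    ultimately show "1 \<le> ennreal (1 / \<delta>\<^sup>2) * U l'" by simp
  qed
  have "emeasure ?P {l'. test_norm \<phi> \<nu>' (\<lambda>j. l j - l' j) \<ge> ennreal \<delta>}
      \<le> emeasure ?P {l' \<in> space ?P. 1 \<le> ennreal (1 / \<delta>\<^sup>2) * U l'}"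
    by (rule emeasure_mono [OF sub]) measurable
  also have "\<dots> \<le> ennreal (1 / \<delta>\<^sup>2) * (\<integral>\<^sup>+l'. U l' * indicator (space ?P) l' \<partial>?P)"
    by (rule nn_integral_Markov_inequality) auto
  also have "(\<integral>\<^sup>+l'. U l' * indicator (space ?P) l' \<partial>?P) = (\<integral>\<^sup>+l'. U l' \<partial>?P)"
    by (simp add: sp)
  also have "\<dots> = (\<Sum>j. ennreal (\<phi> j \<bullet> \<Lambda>' (\<phi> j)) * ennreal (coordinate_risk \<phi> \<gamma> \<sigma> l N D j))"
    unfolding U_def
    by (subst nn_integral_suminf)
       (simp_all add: term_meas borel_measurable_times_ennreal nn_integral_cmult
          posterior_second_moment [where l = l, OF \<sigma>])
  finally show ?thesis .
qed

section \<open>Expected risk and contraction\<close>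

lemma coordinate_risk_measurable:
  fixes \<phi> :: "nat \<Rightarrow> 'h::{real_inner,banach,second_countable_topology}"
  shows "(\<lambda>D. coordinate_risk \<phi> \<gamma> \<sigma> l N D j)
    \<in> borel_measurable ((\<Pi>\<^sub>M n\<in>{..<N}. borel) \<Otimes>\<^sub>M (\<Pi>\<^sub>M jn\<in>UNIV \<times> {..<N}. borel))"
    (is "_ \<in> borel_measurable ?B")
proof -
  have [measurable]: "(\<lambda>D. fst D n) \<in> measurable ?B borel" "(\<lambda>D. snd D (j, n)) \<in> measurable ?B borel"
    if "n < N" for n
    using measurable_compose [OF measurable_fst measurable_component_singleton [of n "{..<N}" "\<lambda>_. borel"]]
      measurable_compose [OF measurable_snd
        measurable_component_singleton [of "(j, n)" "UNIV \<times> {..<N}" "\<lambda>_. borel"]] that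
    by auto
  show ?thesis unfolding coordinate_risk_eq by measurable
qed

text \<open>
  Tonelli's theorem: integrate out first the noise, then the inputs, in each coordinate separately.
  The coordinates of an input may be dependent, since the risk is a sum over them.
\<close>
lemma expected_risk_le:
  fixes \<phi> :: "nat \<Rightarrow> 'h::{real_inner,banach,second_countable_topology}"
  assumes T: "training_distribution \<phi> \<nu> \<Lambda>" and K: "K > 0"
    and v: "\<And>j. \<phi> j \<bullet> \<Lambda> (\<phi> j) > 0"
    and K4: "\<And>h. (\<integral>\<^sup>+x. ennreal ((h \<bullet> x) ^ 4) \<partial>\<nu>) \<le> ennreal (K * (h \<bullet> \<Lambda> h)\<^sup>2)"
    and N: "N \<ge> 1" and \<gamma>: "\<gamma> > 0"
  shows "(\<integral>\<^sup>+D. (\<Sum>j. \<theta> j * ennreal (coordinate_risk \<phi> \<gamma> \<sigma> l N D j)) \<partial>data_law \<phi> \<nu> \<gamma> l N)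
    \<le> (\<Sum>j. \<theta> j * ennreal (((l j)\<^sup>2 + 2 * (\<sigma> j)\<^sup>2) *
        (2 / (1 + real N / \<gamma>\<^sup>2 * (\<sigma> j)\<^sup>2 * (\<phi> j \<bullet> \<Lambda> (\<phi> j))) + exp (- (real N / (8 * K))))))"
proof -
  from T interpret prob_space \<nu> by (simp add: training_distribution_def)
  have sets [measurable_cong]: "sets \<nu> = sets borel"
    using T by (auto simp: training_distribution_def)
  let ?I = "(UNIV :: nat set) \<times> {..<N}"
  let ?P = "\<Pi>\<^sub>M n\<in>{..<N}. \<nu>" and ?Q = "\<Pi>\<^sub>M jn\<in>?I. gaussian 0 1"
  let ?B = "(\<Pi>\<^sub>M n\<in>{..<N}. borel) \<Otimes>\<^sub>M (\<Pi>\<^sub>M jn\<in>?I. borel) :: ((nat \<Rightarrow> 'h) \<times> (nat \<times> nat \<Rightarrow> real)) measure"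
  define Y where "Y X \<xi> = (\<lambda>(j, n)\<in>?I. (\<phi> j \<bullet> X n) * l j + \<gamma> * \<xi> (j, n))" for X \<xi>
  interpret P: prob_space ?P by (rule prob_space_PiM) unfold_locales
  interpret Q: prob_space ?Q by (rule prob_space_PiM) (rule gaussian_moments, simp)
  interpret PQ: pair_prob_space ?P ?Q ..
  have X1: "(\<lambda>X. X n) \<in> measurable ?P borel" if "n < N" for n
    using measurable_component_singleton [of n "{..<N}" "\<lambda>_. \<nu>"] that
    by (simp cong: measurable_cong_sets add: sets)
  have \<xi>1: "(\<lambda>\<xi>. \<xi> i) \<in> measurable ?Q borel" if "i \<in> ?I" for i
    using measurable_component_singleton [OF that, of "\<lambda>_. gaussian 0 1"]
    by (simp add: measurable_cong_sets [OF refl sets_gaussian])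
  have map: "(\<lambda>(X, \<xi>). (X, Y X \<xi>)) \<in> measurable (?P \<Otimes>\<^sub>M ?Q) ?B"
  proof -
    have "(\<lambda>p. fst p) \<in> measurable (?P \<Otimes>\<^sub>M ?Q) (\<Pi>\<^sub>M n\<in>{..<N}. borel)"
      using sets_PiM_cong [of "{..<N}" "{..<N}" "\<lambda>_. \<nu>" "\<lambda>_. borel"] sets
      by (simp cong: measurable_cong_sets)
    moreover have "(\<lambda>p. Y (fst p) (snd p)) \<in> measurable (?P \<Otimes>\<^sub>M ?Q) (\<Pi>\<^sub>M jn\<in>?I. borel)"
      unfolding Y_def
    proof (rule measurable_restrict)
      fix i assume i: "i \<in> ?I"
      obtain j n where jn: "i = (j, n)" "n < N" using i by auto
      have [measurable]: "(\<lambda>p. fst p n) \<in> measurable (?P \<Otimes>\<^sub>M ?Q) borel"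
        "(\<lambda>p. snd p (j, n)) \<in> measurable (?P \<Otimes>\<^sub>M ?Q) borel"
        using measurable_compose [OF measurable_fst X1 [OF jn(2)]]
          measurable_compose [OF measurable_snd \<xi>1 [of "(j, n)"]] jn by auto
      show "(\<lambda>p. case i of (j, n) \<Rightarrow> (\<phi> j \<bullet> fst p n) * l j + \<gamma> * snd p (j, n)) \<in> borel_measurable (?P \<Otimes>\<^sub>M ?Q)"
        unfolding jn by simp
    qed
    ultimately show ?thesis by (simp add: split_beta' measurable_Pair)
  qed
  note risk_meas = coordinate_risk_measurable [of \<phi> \<gamma> \<sigma> l N]
  have risk_meas2: "(\<lambda>(X, \<xi>). ennreal (coordinate_risk \<phi> \<gamma> \<sigma> l N (X, Y X \<xi>) j)) \<in> borel_measurable (?P \<Otimes>\<^sub>M ?Q)" for j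
    using measurable_compose [OF map measurable_compose [OF risk_meas [of j] measurable_ennreal]]
    by (simp add: split_beta')
  have coord: "(\<integral>\<^sup>+p. (case p of (X, \<xi>) \<Rightarrow> ennreal (coordinate_risk \<phi> \<gamma> \<sigma> l N (X, Y X \<xi>) j)) \<partial>(?P \<Otimes>\<^sub>M ?Q))
      \<le> ennreal (((l j)\<^sup>2 + 2 * (\<sigma> j)\<^sup>2) *
        (2 / (1 + real N / \<gamma>\<^sup>2 * (\<sigma> j)\<^sup>2 * (\<phi> j \<bullet> \<Lambda> (\<phi> j))) + exp (- (real N / (8 * K)))))" for j
  proof -
    let ?a = "real N / \<gamma>\<^sup>2 * (\<sigma> j)\<^sup>2"
    let ?G = "\<lambda>X. 1 / real N * (\<Sum>n<N. (\<phi> j \<bullet> X n)\<^sup>2)"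
    have "(\<integral>\<^sup>+p. (case p of (X, \<xi>) \<Rightarrow> ennreal (coordinate_risk \<phi> \<gamma> \<sigma> l N (X, Y X \<xi>) j)) \<partial>(?P \<Otimes>\<^sub>M ?Q))
      = (\<integral>\<^sup>+X. \<integral>\<^sup>+\<xi>. ennreal (coordinate_risk \<phi> \<gamma> \<sigma> l N (X, Y X \<xi>) j) \<partial>?Q \<partial>?P)"
      by (subst Q.nn_integral_fst [symmetric, OF risk_meas2]) simp
    also have "\<dots> \<le> (\<integral>\<^sup>+X. ennreal ((l j)\<^sup>2 + 2 * (\<sigma> j)\<^sup>2) * ennreal (1 / (1 + ?a * ?G X)) \<partial>?P)"
      unfolding Y_def
      by (intro nn_integral_mono order_trans [OF conditional_risk_le [OF N \<gamma>]])
         (rule eq_refl, rule ennreal_mult', simp)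
    also have "\<dots> = ennreal ((l j)\<^sup>2 + 2 * (\<sigma> j)\<^sup>2) * (\<integral>\<^sup>+X. ennreal (1 / (1 + ?a * ?G X)) \<partial>?P)"
      using X1 by (intro nn_integral_cmult) measurable
    also have "\<dots> \<le> ennreal ((l j)\<^sup>2 + 2 * (\<sigma> j)\<^sup>2) *
        ennreal (2 / (1 + ?a * (\<phi> j \<bullet> \<Lambda> (\<phi> j))) + exp (- (real N / (8 * K))))"
      by (intro mult_left_mono expected_shrinkage_le [OF T K v K4 N]) auto
    finally show ?thesis by (simp add: ennreal_mult')
  qed
  have law: "data_law \<phi> \<nu> \<gamma> l N = distr (?P \<Otimes>\<^sub>M ?Q) ?B (\<lambda>(X, \<xi>). (X, Y X \<xi>))"
    unfolding data_law_def Y_def ..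
  have "(\<integral>\<^sup>+D. (\<Sum>j. \<theta> j * ennreal (coordinate_risk \<phi> \<gamma> \<sigma> l N D j)) \<partial>data_law \<phi> \<nu> \<gamma> l N)
     = (\<integral>\<^sup>+p. (\<Sum>j. \<theta> j * (case p of (X, \<xi>) \<Rightarrow> ennreal (coordinate_risk \<phi> \<gamma> \<sigma> l N (X, Y X \<xi>) j))) \<partial>(?P \<Otimes>\<^sub>M ?Q))"
    unfolding law using risk_meas by (subst nn_integral_distr [OF map]) (auto simp: split_beta')
  also have "\<dots> = (\<Sum>j. \<theta> j * (\<integral>\<^sup>+p. (case p of (X, \<xi>) \<Rightarrow> ennreal (coordinate_risk \<phi> \<gamma> \<sigma> l N (X, Y X \<xi>) j)) \<partial>(?P \<Otimes>\<^sub>M ?Q)))"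
    using risk_meas2 by (subst nn_integral_suminf) (auto simp: nn_integral_cmult)
  also have "\<dots> \<le> (\<Sum>j. \<theta> j * ennreal (((l j)\<^sup>2 + 2 * (\<sigma> j)\<^sup>2) *
        (2 / (1 + real N / \<gamma>\<^sup>2 * (\<sigma> j)\<^sup>2 * (\<phi> j \<bullet> \<Lambda> (\<phi> j))) + exp (- (real N / (8 * K))))))"
    by (intro suminf_le mult_left_mono coord) auto
  finally show ?thesis .
qed

text \<open>
  The coordinatewise bounds, summed: the truth contributes a damped Sobolev series, the prior variance a
  damped power series, and the exponentially small probabilities contribute
  \<open>exp (- N / (8 * K))\<close> times a series that converges because \<open>\<alpha>' + s > 0\<close> and \<open>\<alpha>' + p > 1 / 2\<close>.
\<close>
lemma expected_risk_rate:
  fixes \<phi> :: "nat \<Rightarrow> 'h::{real_inner,banach,second_countable_topology}"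
  assumes on: "orthonormal_basis \<phi>" and \<gamma>: "\<gamma> > 0"
    and T: "training_distribution \<phi> \<nu> \<Lambda>" and M: "assumption_M \<phi> \<nu> \<Lambda>"
    and \<sigma>: "\<And>j. \<sigma> j > 0"
    and as: "\<alpha>' + s > 0" and q: "\<alpha> + p > 0" and ap: "\<alpha>' + p > 1 / 2"
    and l: "l \<in> sobolev_seq s"
    and \<sigma>_rate: "(\<lambda>j. (\<sigma> j)\<^sup>2) \<in> \<Theta>(\<lambda>j. real (Suc j) powr (- 2 * p))"
    and \<Lambda>_rate: "(\<lambda>j. \<phi> j \<bullet> \<Lambda> (\<phi> j)) \<in> \<Omega>(\<lambda>j. real (Suc j) powr (- 2 * \<alpha>))"
    and \<theta>_rate: "\<theta> \<in> O(\<lambda>j. real (Suc j) powr (- 2 * \<alpha>'))"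
  obtains r A where "\<And>N. r N \<ge> 0" "r \<in> o(\<lambda>N. real N powr (- (\<alpha>' + s) / (\<alpha> + p)))" "A \<ge> 0"
    "\<And>N. N \<ge> 3 \<Longrightarrow>
      (\<integral>\<^sup>+D. (\<Sum>j. ennreal (\<theta> j) * ennreal (coordinate_risk \<phi> \<gamma> \<sigma> l N D j)) \<partial>data_law \<phi> \<nu> \<gamma> l N)
        \<le> ennreal (A * (rate_rho \<alpha> \<alpha>' p N + r N))"
proof -
  define v where "v j = \<phi> j \<bullet> \<Lambda> (\<phi> j)" for j
  have v: "v j > 0" for j
  proof -
    have "\<phi> j \<bullet> \<phi> j = 1" using on by (simp add: orthonormal_basis_def)
    then have "\<phi> j \<noteq> 0" by auto
    then show ?thesis using T by (simp add: training_distribution_def v_def)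
  qed
  obtain K where K: "K \<ge> 3"
    "\<And>h. (\<integral>\<^sup>+x. ennreal ((h \<bullet> x) ^ 4) \<partial>\<nu>) \<le> ennreal (K * (h \<bullet> \<Lambda> h)\<^sup>2)"
    using fourth_moment_marginal [OF T M] by blast
  have K0: "K > 0" using K by simp
  obtain S where S: "S > 0" "\<And>j. (\<sigma> j)\<^sup>2 \<le> S * real (Suc j) powr (- 2 * p)"
    using bigo_pointwise_bound [OF bigthetaD1 [OF \<sigma>_rate]] by auto
  have sq: "(\<sigma> j)\<^sup>2 > 0" for j using \<sigma> [of j] by simp
  obtain S' where S'0: "S' > 0" "\<And>j. \<bar>real (Suc j) powr (- 2 * p)\<bar> \<le> S' * (\<sigma> j)\<^sup>2"
    using bigo_pointwise_bound [OF bigthetaD2 [OF \<sigma>_rate, unfolded bigomega_iff_bigo] sq] by blast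
  obtain V where V0: "V > 0" "\<And>j. \<bar>real (Suc j) powr (- 2 * \<alpha>)\<bar> \<le> V * v j"
    using bigo_pointwise_bound [OF \<Lambda>_rate [unfolded bigomega_iff_bigo, folded v_def] v] by blast
  have S': "S' > 0" "real (Suc j) powr (- 2 * p) \<le> S' * (\<sigma> j)\<^sup>2"
    and V: "V > 0" "real (Suc j) powr (- 2 * \<alpha>) \<le> V * v j" for j
    using S'0 V0 by (auto simp: abs_le_iff)
  obtain T' where T'0: "T' > 0" "\<And>j. \<bar>\<theta> j\<bar> \<le> T' * real (Suc j) powr (- 2 * \<alpha>')"
    using bigo_pointwise_bound [OF \<theta>_rate] by auto
  have T': "T' > 0" "\<theta> j \<le> T' * real (Suc j) powr (- 2 * \<alpha>')" for j
    using T'0 by (auto simp: abs_le_iff)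
  obtain r C where r: "\<And>N. r N \<ge> 0" "r \<in> o(\<lambda>N. real N powr (- (\<alpha>' + s) / (\<alpha> + p)))" and C: "C \<ge> 0"
    and bias: "\<And>N. N \<ge> 1 \<Longrightarrow>
      (\<Sum>j. real (Suc j) powr (- 2 * \<alpha>') * (l j)\<^sup>2 * damped (\<alpha> + p) N j) \<le> r N + C / real N"
    using sobolev_damped_series_le [OF l as q] by blast
  obtain C' where C': "C' \<ge> 0" and variance: "\<And>N. N \<ge> 3 \<Longrightarrow>
      (\<Sum>j. real (Suc j) powr (- 2 * (\<alpha>' + p)) * damped (\<alpha> + p) N j) \<le> C' * rate_rho \<alpha> \<alpha>' p N"
    using powr_damped_series_le_rate [OF q ap] by blast
  \<comment> \<open>The minimum with \<open>1\<close> lets \<open>c\<close> be pulled out of \<open>1 + N * y\<close> as a whole.\<close>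
  define c where "c = min 1 (1 / (\<gamma>\<^sup>2 * S' * V))"
  have c: "0 < c" "c \<le> 1" "c \<le> 1 / (\<gamma>\<^sup>2 * S' * V)"
    using \<gamma> S' V by (auto simp: c_def)
  have shrink: "2 / (1 + real N / \<gamma>\<^sup>2 * (\<sigma> j)\<^sup>2 * v j) \<le> 2 / c * damped (\<alpha> + p) N j" for N j
  proof -
    define y where "y = real (Suc j) powr (- 2 * (\<alpha> + p))"
    have y: "y > 0" by (simp add: y_def)
    have "y = real (Suc j) powr (- 2 * p) * real (Suc j) powr (- 2 * \<alpha>)"
      unfolding y_def by (simp add: powr_add [symmetric] algebra_simps del: of_nat_Suc)
    also have "\<dots> \<le> (S' * (\<sigma> j)\<^sup>2) * (V * v j)"
      using S' V by (intro mult_mono) auto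
    finally have "c * y \<le> 1 / (\<gamma>\<^sup>2 * S' * V) * ((S' * (\<sigma> j)\<^sup>2) * (V * v j))"
      using c y S'(1) V(1) by (intro mult_mono) auto
    also have "\<dots> = (\<sigma> j)\<^sup>2 * v j / \<gamma>\<^sup>2"
      using S' V \<gamma> by (simp add: field_simps)
    finally have "real N * (c * y) \<le> real N * ((\<sigma> j)\<^sup>2 * v j / \<gamma>\<^sup>2)"
      by (rule mult_left_mono) simp
    then have "c * (1 + real N * y) \<le> 1 + real N / \<gamma>\<^sup>2 * (\<sigma> j)\<^sup>2 * v j"
      using c by (simp add: algebra_simps)
    moreover have "0 < c * (1 + real N * y)" using c y by (intro mult_pos_pos add_pos_nonneg) auto
    ultimately have "2 / (1 + real N / \<gamma>\<^sup>2 * (\<sigma> j)\<^sup>2 * v j) \<le> 2 / (c * (1 + real N * y))"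
      by (rule frac_le [OF zero_le_numeral order_refl, rotated])
    then show ?thesis by (simp add: damped_def y_def)
  qed
  let ?f = "\<lambda>j. real (Suc j) powr (- 2 * \<alpha>') * (l j)\<^sup>2"
  let ?g = "\<lambda>j. real (Suc j) powr (- 2 * (\<alpha>' + p))"
  have smf: "summable ?f"
  proof (rule summable_comparison_test')
    show "summable (\<lambda>j. real (Suc j) powr (2 * s) * (l j)\<^sup>2)" using l by (simp add: sobolev_seq_def)
    show "norm (?f j) \<le> real (Suc j) powr (2 * s) * (l j)\<^sup>2" for j
      using as by (auto simp: abs_mult intro!: mult_right_mono powr_mono)
  qed
  have smg: "summable ?g"
    using ap summable_real_powr_iff [of "- 2 * (\<alpha>' + p)"]
      summable_Suc_iff [of "\<lambda>j. real j powr (- 2 * (\<alpha>' + p))"] by simp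
  have smd: "summable (\<lambda>j. h j * damped (\<alpha> + p) N j)" if "summable h" "\<And>j. 0 \<le> h j" for h N
  proof (rule summable_comparison_test' [OF that(1)])
    show "norm (h j * damped (\<alpha> + p) N j) \<le> h j" for j
      using that(2) [of j] damped_pos [of "\<alpha> + p" N j] mult_left_mono [OF damped_le_1 that(2)]
      by (simp add: abs_mult)
  qed
  define L where "L = suminf ?f + 2 * S * suminf ?g"
  have L: "L \<ge> 0"
    unfolding L_def using S by (intro add_nonneg_nonneg mult_nonneg_nonneg suminf_nonneg smf smg) auto
  define A where "A = T' * (2 / c * (1 + C + 2 * S * C') + 8 * K * L)"
  have A: "A \<ge> 0" unfolding A_def using T' c C C' S K L by (intro mult_nonneg_nonneg add_nonneg_nonneg) auto
  have "(\<integral>\<^sup>+D. (\<Sum>j. ennreal (\<theta> j) * ennreal (coordinate_risk \<phi> \<gamma> \<sigma> l N D j)) \<partial>data_law \<phi> \<nu> \<gamma> l N)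
        \<le> ennreal (A * (rate_rho \<alpha> \<alpha>' p N + r N))" if N: "N \<ge> 3" for N
  proof -
    let ?d = "damped (\<alpha> + p) N"
    let ?e = "exp (- (real N / (8 * K)))"
    let ?\<rho> = "rate_rho \<alpha> \<alpha>' p N"
    define b where "b j = T' * (2 / c * (?f j * ?d j + 2 * S * (?g j * ?d j)) + ?e * (?f j + 2 * S * ?g j))" for j
    define B where "B = T' * (2 / c * ((\<Sum>j. ?f j * ?d j) + 2 * S * (\<Sum>j. ?g j * ?d j)) + ?e * L)"
    have d0: "0 \<le> ?d j" for j using damped_pos [of "\<alpha> + p" N j] by simp
    have "b sums B"
      unfolding b_def B_def L_def
      by (intro sums_mult sums_add summable_sums smf smg smd) auto
    have b0: "0 \<le> b j" for j
      unfolding b_def using T' c S d0 by (intro mult_nonneg_nonneg add_nonneg_nonneg) auto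
    have le_b: "ennreal (\<theta> j) * ennreal (((l j)\<^sup>2 + 2 * (\<sigma> j)\<^sup>2) *
        (2 / (1 + real N / \<gamma>\<^sup>2 * (\<sigma> j)\<^sup>2 * v j) + ?e)) \<le> ennreal (b j)" for j
    proof -
      have "ennreal (\<theta> j) * ennreal (((l j)\<^sup>2 + 2 * (\<sigma> j)\<^sup>2) *
        (2 / (1 + real N / \<gamma>\<^sup>2 * (\<sigma> j)\<^sup>2 * v j) + ?e))
        \<le> ennreal (T' * real (Suc j) powr (- 2 * \<alpha>')) *
          ennreal (((l j)\<^sup>2 + 2 * (S * real (Suc j) powr (- 2 * p))) * (2 / c * ?d j + ?e))"
        using S T' v \<gamma> d0 c by (intro mult_mono ennreal_leI add_mono shrink order_refl mult_left_mono)
           (auto intro!: add_nonneg_nonneg divide_nonneg_nonneg mult_nonneg_nonneg simp: less_imp_le)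
      also have "\<dots> = ennreal (T' * real (Suc j) powr (- 2 * \<alpha>') *
          (((l j)\<^sup>2 + 2 * (S * real (Suc j) powr (- 2 * p))) * (2 / c * ?d j + ?e)))"
        using T' by (intro ennreal_mult' [symmetric]) simp
      also have "T' * real (Suc j) powr (- 2 * \<alpha>') *
          (((l j)\<^sup>2 + 2 * (S * real (Suc j) powr (- 2 * p))) * (2 / c * ?d j + ?e)) = b j"
      proof -
        have "?g j = real (Suc j) powr (- 2 * \<alpha>') * real (Suc j) powr (- 2 * p)"
          by (simp add: powr_add [symmetric] algebra_simps del: of_nat_Suc)
        then show ?thesis unfolding b_def by (simp only:) (simp only: algebra_simps)
      qed
      finally show ?thesis .
    qed
    have "(\<integral>\<^sup>+D. (\<Sum>j. ennreal (\<theta> j) * ennreal (coordinate_risk \<phi> \<gamma> \<sigma> l N D j)) \<partial>data_law \<phi> \<nu> \<gamma> l N)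
        \<le> (\<Sum>j. ennreal (\<theta> j) * ennreal (((l j)\<^sup>2 + 2 * (\<sigma> j)\<^sup>2) *
          (2 / (1 + real N / \<gamma>\<^sup>2 * (\<sigma> j)\<^sup>2 * (\<phi> j \<bullet> \<Lambda> (\<phi> j))) + ?e)))"
      using N by (intro expected_risk_le [OF T K0 v [unfolded v_def] K(2) _ \<gamma>]) auto
    also have "\<dots> \<le> (\<Sum>j. ennreal (b j))"
      by (intro suminf_le le_b [unfolded v_def]) auto
    also have "\<dots> = ennreal B" by (rule suminf_ennreal_eq [OF b0 \<open>b sums B\<close>])
    also have "B \<le> A * (?\<rho> + r N)"
    proof -
      have \<rho>: "1 / real N \<le> ?\<rho>" by (rule rate_rho_ge_inverse [OF q N])
      have "?e \<le> 8 * K / real N"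
      proof -
        have "real N / (8 * K) \<le> exp (real N / (8 * K))"
          using exp_ge_add_one_self [of "real N / (8 * K)"] by linarith
        then have "1 / exp (real N / (8 * K)) \<le> 1 / (real N / (8 * K))"
          using N K0 by (intro divide_left_mono) auto
        then show ?thesis unfolding exp_minus inverse_eq_divide by simp
      qed
      also have "\<dots> \<le> 8 * K * ?\<rho>" using \<rho> K0 mult_left_mono [OF \<rho>, of "8 * K"] by simp
      also have "\<dots> \<le> 8 * K * (?\<rho> + r N)" using K0 r(1) [of N] by (intro mult_left_mono) auto
      finally have "?e * L \<le> 8 * K * (?\<rho> + r N) * L"
        using L by (rule mult_right_mono)
      then have e: "?e * L \<le> 8 * K * L * (?\<rho> + r N)"
        by (simp only: mult_ac)
      have "(\<Sum>j. ?f j * ?d j) \<le> r N + C / real N" using bias [of N] N by simp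
      also have "\<dots> \<le> r N + C * ?\<rho>" using mult_left_mono [OF \<rho> C] by simp
      also have "\<dots> \<le> (1 + C) * (?\<rho> + r N)"
        using order_trans [OF divide_nonneg_nonneg \<rho>] mult_nonneg_nonneg [OF C r(1) [of N]]
        by (simp add: algebra_simps)
      finally have f: "(\<Sum>j. ?f j * ?d j) \<le> (1 + C) * (?\<rho> + r N)" .
      have "(\<Sum>j. ?g j * ?d j) \<le> C' * ?\<rho>" by (rule variance [OF N])
      also have "\<dots> \<le> C' * (?\<rho> + r N)" using C' r(1) [of N] by (intro mult_left_mono) auto
      finally have g: "2 * S * (\<Sum>j. ?g j * ?d j) \<le> 2 * S * (C' * (?\<rho> + r N))"
        using S by (intro mult_left_mono) auto
      have "B \<le> T' * (2 / c * ((1 + C) * (?\<rho> + r N) + 2 * S * (C' * (?\<rho> + r N))) + (8 * K * L) * (?\<rho> + r N))"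
        unfolding B_def using T' c by (intro mult_left_mono add_mono e f g) auto
      also have "\<dots> = A * (?\<rho> + r N)" unfolding A_def by (simp only: algebra_simps)
      finally show ?thesis .
    qed
    finally show ?thesis by (simp add: ennreal_leI)
  qed
  then show thesis using that r A by blast
qed

theorem corollary3p7:
  fixes \<phi> :: "nat \<Rightarrow> 'h::{real_inner,banach,second_countable_topology}"
    and \<nu> :: "'h measure" and \<nu>' :: "(nat \<Rightarrow> real) measure"
    and \<Lambda> \<Lambda>' :: "'h \<Rightarrow> 'h"
    and l \<sigma> :: "nat \<Rightarrow> real"
    and s p \<alpha> \<alpha>' \<gamma> :: real
  assumes "orthonormal_basis \<phi>"
    and "\<gamma> > 0"
    and "training_distribution \<phi> \<nu> \<Lambda>"
    and "test_distribution \<phi> \<nu>' \<Lambda>'"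
    and "\<And>j. \<sigma> j > 0"
    and "\<alpha> > 1/2" and "\<alpha>' \<ge> 0"
    and "min \<alpha> \<alpha>' + s > 0" and "min \<alpha> \<alpha>' + (p - 1/2) > 0"
    and "l \<in> sobolev_seq s"
    and "(\<lambda>j. (\<sigma> j)\<^sup>2) \<in> \<Theta>(\<lambda>j. real (Suc j) powr (- 2 * p))"
    and "(\<lambda>j. \<phi> j \<bullet> \<Lambda> (\<phi> j)) \<in> \<Theta>(\<lambda>j. real (Suc j) powr (- 2 * \<alpha>))"
    and "(\<lambda>j. \<phi> j \<bullet> \<Lambda>' (\<phi> j)) \<in> \<Theta>(\<lambda>j. real (Suc j) powr (- 2 * \<alpha>'))"
    and "assumption_M \<phi> \<nu> \<Lambda>"
  shows "\<exists>r :: nat \<Rightarrow> real.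
           (\<forall>N. r N \<ge> 0) \<and>
           r \<in> o(\<lambda>N. real N powr (- (\<alpha>' + s) / (\<alpha> + p))) \<and>
           (\<forall>\<epsilon> :: nat \<Rightarrow> real.
              (\<forall>N. \<epsilon> N > 0) \<and> (\<lambda>N. (\<epsilon> N)\<^sup>2) \<in> \<Theta>(\<lambda>N. rate_rho \<alpha> \<alpha>' p N + r N) \<longrightarrow>
              contraction_rate \<phi> \<nu> \<nu>' \<gamma> \<sigma> l \<epsilon>)"
proof -
  have as: "\<alpha>' + s > 0" and q: "\<alpha> + p > 0" and ap: "\<alpha>' + p > 1 / 2"
    using assms(8,9) by linarith+
  let ?\<theta> = "\<lambda>j. \<phi> j \<bullet> \<Lambda>' (\<phi> j)"
  let ?\<rho> = "rate_rho \<alpha> \<alpha>' p"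
  let ?R = "\<lambda>N D. \<Sum>j. ennreal (?\<theta> j) * ennreal (coordinate_risk \<phi> \<gamma> \<sigma> l N D j)"
  obtain r A where r: "\<And>N. r N \<ge> 0" "r \<in> o(\<lambda>N. real N powr (- (\<alpha>' + s) / (\<alpha> + p)))"
    and A: "A \<ge> 0" and risk: "\<And>N. N \<ge> 3 \<Longrightarrow>
      (\<integral>\<^sup>+D. ?R N D \<partial>data_law \<phi> \<nu> \<gamma> l N) \<le> ennreal (A * (?\<rho> N + r N))"
    by (rule expected_risk_rate [OF assms(1-3,14,5) as q ap assms(10,11) bigthetaD2 [OF assms(12)]
          bigthetaD1 [OF assms(13)]]) blast
  have r_lim: "r \<longlonglongrightarrow> 0"
  proof -
    have "(\<lambda>N. real N powr (- (\<alpha>' + s) / (\<alpha> + p))) \<longlonglongrightarrow> 0"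
      using as q by (intro tendsto_neg_powr filterlim_real_sequentially) (simp add: divide_neg_pos)
    then show ?thesis
      by (rule bigo_tendsto_zero [OF landau_o.small_imp_big [OF r(2)]])
  qed
  have "contraction_rate \<phi> \<nu> \<nu>' \<gamma> \<sigma> l \<epsilon>"
    if \<epsilon>: "\<And>N. \<epsilon> N > 0" "(\<lambda>N. (\<epsilon> N)\<^sup>2) \<in> \<Theta>(\<lambda>N. ?\<rho> N + r N)" for \<epsilon> :: "nat \<Rightarrow> real"
    unfolding contraction_rate_def
  proof (intro conjI allI impI)
    show "\<epsilon> N > 0" for N by (rule \<epsilon>)
    have "(\<lambda>N. ?\<rho> N + r N) \<longlonglongrightarrow> 0 + 0"
      by (intro tendsto_add rate_rho_tendsto_0 q ap r_lim)
    then have "(\<lambda>N. (\<epsilon> N)\<^sup>2) \<longlonglongrightarrow> 0"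
      by (intro bigo_tendsto_zero [OF bigthetaD1 [OF \<epsilon>(2)]]) simp
    then have "(\<lambda>N. sqrt ((\<epsilon> N)\<^sup>2)) \<longlonglongrightarrow> sqrt 0" by (rule tendsto_real_sqrt)
    then show "\<epsilon> \<longlonglongrightarrow> 0" using \<epsilon>(1) by (simp add: less_imp_le abs_of_pos)
  next
    fix M :: "nat \<Rightarrow> real"
    assume M: "(\<forall>N. 0 < M N) \<and> filterlim M at_top sequentially"
    let ?E = "\<lambda>N D. emeasure (posterior \<phi> \<gamma> \<sigma> N D)
                      {l'. test_norm \<phi> \<nu>' (\<lambda>j. l j - l' j) \<ge> ennreal (M N * \<epsilon> N)}"
    obtain \<kappa> where \<kappa>: "\<kappa> > 0" "\<forall>\<^sub>F N in sequentially. norm (?\<rho> N + r N) \<le> \<kappa> * norm ((\<epsilon> N)\<^sup>2)"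
      using bigthetaD2 [OF \<epsilon>(2)] unfolding bigomega_iff_bigo by (elim landau_o.bigE)
    have upper: "\<forall>\<^sub>F N in sequentially.
        (\<integral>\<^sup>+D. ?E N D \<partial>data_law \<phi> \<nu> \<gamma> l N) \<le> ennreal (A * \<kappa> * (1 / M N) ^ 2)"
      using \<kappa>(2) eventually_ge_at_top [of 3]
    proof eventually_elim
      case (elim N)
      have pos: "M N * \<epsilon> N > 0" using M \<epsilon> by simp
      have "(\<integral>\<^sup>+D. ?E N D \<partial>data_law \<phi> \<nu> \<gamma> l N)
          \<le> (\<integral>\<^sup>+D. ennreal (1 / (M N * \<epsilon> N)\<^sup>2) * ?R N D \<partial>data_law \<phi> \<nu> \<gamma> l N)"
        by (intro nn_integral_mono posterior_tail_le [OF assms(1,4,5) pos])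
      also have "\<dots> = ennreal (1 / (M N * \<epsilon> N)\<^sup>2) * (\<integral>\<^sup>+D. ?R N D \<partial>data_law \<phi> \<nu> \<gamma> l N)"
      proof (rule nn_integral_cmult)
        have "(\<lambda>D. coordinate_risk \<phi> \<gamma> \<sigma> l N D j) \<in> borel_measurable (data_law \<phi> \<nu> \<gamma> l N)" for j
          using coordinate_risk_measurable [of \<phi> \<gamma> \<sigma> l N j] by (simp add: data_law_def)
        then show "?R N \<in> borel_measurable (data_law \<phi> \<nu> \<gamma> l N)" by measurable
      qed
      also have "\<dots> \<le> ennreal (1 / (M N * \<epsilon> N)\<^sup>2) * ennreal (A * (?\<rho> N + r N))"
        using elim by (intro mult_left_mono risk) auto
      also have "\<dots> = ennreal (1 / (M N * \<epsilon> N)\<^sup>2 * (A * (?\<rho> N + r N)))"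
        by (rule ennreal_mult' [symmetric]) simp
      also have "1 / (M N * \<epsilon> N)\<^sup>2 * (A * (?\<rho> N + r N)) \<le> 1 / (M N * \<epsilon> N)\<^sup>2 * (A * (\<kappa> * (\<epsilon> N)\<^sup>2))"
        using elim A by (intro mult_left_mono) auto
      also have "\<dots> = A * \<kappa> * (1 / M N) ^ 2"
        using \<epsilon>(1) [of N] M by (simp add: power_mult_distrib power_divide field_simps)
      finally show ?case by (simp add: ennreal_leI)
    qed
    have "(\<lambda>N. 1 / M N) \<longlonglongrightarrow> 0"
      using M by (intro tendsto_divide_0 [OF tendsto_const] filterlim_at_top_imp_at_infinity) auto
    then have "(\<lambda>N. A * \<kappa> * (1 / M N) ^ 2) \<longlonglongrightarrow> A * \<kappa> * 0 ^ 2" by (intro tendsto_intros)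
    then have "(\<lambda>N. ennreal (A * \<kappa> * (1 / M N) ^ 2)) \<longlonglongrightarrow> 0"
      using tendsto_ennrealI by fastforce
    then show "(\<lambda>N. \<integral>\<^sup>+D. ?E N D \<partial>data_law \<phi> \<nu> \<gamma> l N) \<longlonglongrightarrow> 0"
      by (rule tendsto_sandwich [OF _ upper tendsto_const, rotated]) simp
  qed
  then show ?thesis using r by blast
qed

end
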